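(* Let $\rho,\sigma$ be faithful density operators on $\mathbb C^d$ and let $\alpha>0$, $\alpha\neq1$, be finite. For a rank-one PVM $P$ let $D_\alpha(P)$ be the classical Rényi divergence of order $\alpha$ of the outcome distributions of $P$ on $\rho$ and $\sigma$. Then: (1) every local maximum of $P\mapsto D_\alpha(P)$ over rank-one PVMs is globally optimal over all POVMs; (2) every second-order stationary rank-one PVM of $P\mapsto D_\alpha(P)$ is globally optimal over all POVMs; (3) every critical rank-one PVM of $P\mapsto D_\alpha(P)$ that is not globally optimal over all POVMs admits an explicit two-level direction of strictly increasing measured Rényi divergence. The same three statements hold with $D_\alpha$ replaced by the classical relative entropy $D_1(p\Vert q)=\sum_jp_j\log(p_j/q_j)$ (measured relative entropy, $\alpha=1$).
   Context: Density operators are positive semidefinite trace-one matrices; faithful means positive definite. A rank-one PVM is $P=(P_j)_{j=1}^d$, $P_j=|j\rangle\langle j|$ for an orthonormal basis; ordered rank-one PVMs form the flag manifold $U(d)/U(1)^d$. Outcome distributions: $p_j=\mathrm{Tr}(\rho P_j)$, $q_j=\mathrm{Tr}(\sigma P_j)$. For $\alpha\ne1$, $D_\alpha(p\Vert q)=\frac1{\alpha-1}\log\sum_yp_y^\alpha q_y^{1-\alpha}$. The measured divergence of order $\alpha$ is the supremum of $D_\alpha\bigl((\mathrm{Tr}\rho M_y)_y\Vert(\mathrm{Tr}\sigma M_y)_y\bigr)$ over all finite POVMs $M$; a PVM is globally optimal over all POVMs if it attains this supremum. Critical means all first derivatives along tangent directions of the flag manifold vanish; second-order stationary means critical with negative semidefinite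 Riemannian Hessian. An explicit two-level direction of strictly increasing divergence at a critical $P$ means: there are $j\ne k$ with equal likelihood ratio $p_j/q_j=p_k/q_k=:t$ and $a_{jk}:=\langle j|(\rho-t\sigma)|k\rangle\ne0$ such that, with $\phi=-\arg a_{jk}$, along the rotation $|j(\theta)\rangle=\cos\theta|j\rangle+e^{i\phi}\sin\theta|k\rangle$, $|k(\theta)\rangle=-e^{-i\phi}\sin\theta|j\rangle+\cos\theta|k\rangle$ (other basis vectors fixed) the divergence has strictly positive second derivative at $\theta=0$. *)

theory Defs
  imports "HOL-Analysis.Analysis"
begin

section \<open>Operators on the complex space of dimension \<open>CARD('d)\<close>\<close>

definition cinner :: "complex^'d \<Rightarrow> complex^'d \<Rightarrow> complex" where
  "cinner v w = (\<Sum>i\<in>UNIV. cnj (v $ i) * w $ i)"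

definition adjoint_mat :: "complex^'d^'d \<Rightarrow> complex^'d^'d" where
  "adjoint_mat A = (\<chi> i j. cnj (A $ j $ i))"

definition hermitian :: "complex^'d^'d \<Rightarrow> bool" where
  "hermitian A \<longleftrightarrow> adjoint_mat A = A"

definition pos_semidef :: "complex^'d^'d \<Rightarrow> bool" where
  "pos_semidef A \<longleftrightarrow> hermitian A \<and> (\<forall>v. 0 \<le> Re (cinner v (A *v v)))"

definition pos_def :: "complex^'d^'d \<Rightarrow> bool" where
  "pos_def A \<longleftrightarrow> hermitian A \<and> (\<forall>v. v \<noteq> 0 \<longrightarrow> 0 < Re (cinner v (A *v v)))"

definition density_operator :: "complex^'d^'d \<Rightarrow> bool" where
  "density_operator \<rho> \<longleftrightarrow> pos_semidef \<rho> \<and> trace \<rho> = 1"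

definition faithful_density_operator :: "complex^'d^'d \<Rightarrow> bool" where
  "faithful_density_operator \<rho> \<longleftrightarrow> density_operator \<rho> \<and> pos_def \<rho>"


section \<open>Measurements\<close>

text \<open>A finite POVM has outcomes \<open>0, \<dots>, m - 1\<close>; values of \<open>M\<close> at other indices are irrelevant.\<close>

definition povm :: "nat \<Rightarrow> (nat \<Rightarrow> complex^'d^'d) \<Rightarrow> bool" where
  "povm m M \<longleftrightarrow> (\<forall>y<m. pos_semidef (M y)) \<and> (\<Sum>y<m. M y) = mat 1"

text \<open>An orthonormal family indexed by \<open>'d\<close> has as many members as the dimension, so it is a
  basis.\<close>

definition orthonormal_basis :: "('d \<Rightarrow> complex^'d) \<Rightarrow> bool" where
  "orthonormal_basis b \<longleftrightarrow> (\<forall>i j. cinner (b i) (b j) = (if i = j then 1 else 0))"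

definition ket_bra :: "complex^'d \<Rightarrow> complex^'d^'d" where
  "ket_bra v = (\<chi> r c. v $ r * cnj (v $ c))"

definition pvm_of_basis :: "('d \<Rightarrow> complex^'d) \<Rightarrow> complex^'d^'d^'d" where
  "pvm_of_basis b = (\<chi> j. ket_bra (b j))"

text \<open>An ordered rank-one PVM is the tuple \<open>P\<close> of its projectors \<open>P $ j\<close>. The set of all of them
  is the image of the standard embedding of the flag manifold \<open>U(d)/U(1)\<^sup>d\<close> into the Euclidean
  space of tuples of matrices, whose inner product is
  \<open>P \<bullet> Q = (\<Sum>j. Re (Tr (P\<^sub>j\<^sup>* Q\<^sub>j)))\<close>. The metric it induces is the \<open>U(d)\<close>-invariant metric
  coming, up to a constant factor, from the Frobenius norm on skew-Hermitian matrices.\<close>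

definition rank_one_pvms :: "(complex^'d^'d^'d) set" where
  "rank_one_pvms = {P. \<exists>b. orthonormal_basis b \<and> P = pvm_of_basis b}"


section \<open>Divergences\<close>

text \<open>For \<open>\<alpha> = 1\<close> this is the relative entropy. Outcomes with \<open>p y = q y = 0\<close> contribute \<open>0\<close>
  in both branches, since \<open>0 powr a = 0\<close>; for faithful states \<open>p y\<close> and \<open>q y\<close> can only vanish
  simultaneously.\<close>

definition renyi_divergence :: "real \<Rightarrow> 'y set \<Rightarrow> ('y \<Rightarrow> real) \<Rightarrow> ('y \<Rightarrow> real) \<Rightarrow> real" where
  "renyi_divergence \<alpha> Y p q =
     (if \<alpha> = 1 then (\<Sum>y\<in>Y. p y * ln (p y / q y))
      else 1 / (\<alpha> - 1) * ln (\<Sum>y\<in>Y. p y powr \<alpha> * q y powr (1 - \<alpha>)))"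

definition outcome_prob :: "complex^'d^'d \<Rightarrow> complex^'d^'d \<Rightarrow> real" where
  "outcome_prob \<rho> E = Re (trace (\<rho> ** E))"

definition pvm_divergence ::
    "real \<Rightarrow> complex^'d^'d \<Rightarrow> complex^'d^'d \<Rightarrow> complex^'d^'d^'d \<Rightarrow> real" where
  "pvm_divergence \<alpha> \<rho> \<sigma> P =
     renyi_divergence \<alpha> UNIV (\<lambda>j. outcome_prob \<rho> (P $ j)) (\<lambda>j. outcome_prob \<sigma> (P $ j))"

definition povm_divergence ::
    "real \<Rightarrow> complex^'d^'d \<Rightarrow> complex^'d^'d \<Rightarrow> nat \<Rightarrow> (nat \<Rightarrow> complex^'d^'d) \<Rightarrow> real" where
  "povm_divergence \<alpha> \<rho> \<sigma> m M =
     renyi_divergence \<alpha> {..<m} (\<lambda>y. outcome_prob \<rho> (M y)) (\<lambda>y. outcome_prob \<sigma> (M y))"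

definition measured_divergence :: "real \<Rightarrow> complex^'d^'d \<Rightarrow> complex^'d^'d \<Rightarrow> ereal" where
  "measured_divergence \<alpha> \<rho> \<sigma> =
     Sup {ereal (povm_divergence \<alpha> \<rho> \<sigma> m M) | m M. povm m M}"

definition globally_optimal ::
    "real \<Rightarrow> complex^'d^'d \<Rightarrow> complex^'d^'d \<Rightarrow> complex^'d^'d^'d \<Rightarrow> bool" where
  "globally_optimal \<alpha> \<rho> \<sigma> P \<longleftrightarrow>
     ereal (pvm_divergence \<alpha> \<rho> \<sigma> P) = measured_divergence \<alpha> \<rho> \<sigma>"


section \<open>Calculus on an embedded submanifold \<open>M\<close> of a Euclidean space\<close>

definition local_maximum_on :: "'a::topological_space set \<Rightarrow> ('a \<Rightarrow> real) \<Rightarrow> 'a \<Rightarrow> bool" where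
  "local_maximum_on M f x \<longleftrightarrow> x \<in> M \<and> (\<forall>\<^sub>F y in at x within M. f y \<le> f x)"

definition curve_in :: "'a::euclidean_space set \<Rightarrow> 'a \<Rightarrow> 'a \<Rightarrow> (real \<Rightarrow> 'a) \<Rightarrow> bool" where
  "curve_in M x v \<gamma> \<longleftrightarrow>
     (\<forall>t. \<gamma> t \<in> M) \<and> \<gamma> 0 = x \<and> (\<gamma> has_vector_derivative v) (at 0)"

definition tangent_space :: "'a::euclidean_space set \<Rightarrow> 'a \<Rightarrow> 'a set" where
  "tangent_space M x = {v. \<exists>\<gamma>. curve_in M x v \<gamma>}"

definition has_derivative_along ::
    "'a::euclidean_space set \<Rightarrow> ('a \<Rightarrow> 'b::real_normed_vector) \<Rightarrow> 'a \<Rightarrow> 'a \<Rightarrow> 'b \<Rightarrow> bool" where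
  "has_derivative_along M F x v D \<longleftrightarrow>
     (\<forall>\<gamma>. curve_in M x v \<gamma> \<longrightarrow> ((\<lambda>t. F (\<gamma> t)) has_vector_derivative D) (at 0))"

definition critical_on :: "'a::euclidean_space set \<Rightarrow> ('a \<Rightarrow> real) \<Rightarrow> 'a \<Rightarrow> bool" where
  "critical_on M f x \<longleftrightarrow> x \<in> M \<and> (\<forall>v\<in>tangent_space M x. has_derivative_along M f x v 0)"

text \<open>Gradient and Hessian for the Riemannian metric that \<open>M\<close> inherits from the ambient inner
  product. Its Levi-Civita connection is the tangential part of the ambient derivative, so the
  Hessian \<open>\<langle>\<nabla>\<^sub>v grad f, w\<rangle>\<close> needs no explicit projection when \<open>w\<close> is tangent.\<close>

definition riemannian_gradient :: "'a::euclidean_space set \<Rightarrow> ('a \<Rightarrow> real) \<Rightarrow> 'a \<Rightarrow> 'a" where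
  "riemannian_gradient M f x =
     (THE g. g \<in> tangent_space M x \<and>
             (\<forall>v\<in>tangent_space M x. has_derivative_along M f x v (g \<bullet> v)))"

definition riemannian_hessian ::
    "'a::euclidean_space set \<Rightarrow> ('a \<Rightarrow> real) \<Rightarrow> 'a \<Rightarrow> 'a \<Rightarrow> 'a \<Rightarrow> real" where
  "riemannian_hessian M f x v w =
     (THE D. has_derivative_along M (riemannian_gradient M f) x v D) \<bullet> w"

definition second_order_stationary_on ::
    "'a::euclidean_space set \<Rightarrow> ('a \<Rightarrow> real) \<Rightarrow> 'a \<Rightarrow> bool" where
  "second_order_stationary_on M f x \<longleftrightarrow>
     critical_on M f x \<and> (\<forall>v\<in>tangent_space M x. riemannian_hessian M f x v v \<le> 0)"


section \<open>Two-level directions\<close>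

definition two_level_rotation ::
    "('d \<Rightarrow> complex^'d) \<Rightarrow> 'd \<Rightarrow> 'd \<Rightarrow> real \<Rightarrow> real \<Rightarrow> 'd \<Rightarrow> complex^'d" where
  "two_level_rotation b j k \<phi> \<theta> =
     b(j := complex_of_real (cos \<theta>) *s b j + (cis \<phi> * complex_of_real (sin \<theta>)) *s b k,
       k := (- cis (- \<phi>) * complex_of_real (sin \<theta>)) *s b j + complex_of_real (cos \<theta>) *s b k)"

definition has_pos_second_derivative_at_0 :: "(real \<Rightarrow> real) \<Rightarrow> bool" where
  "has_pos_second_derivative_at_0 g \<longleftrightarrow>
     (\<exists>g' D. (\<forall>\<^sub>F \<theta> in nhds 0. (g has_real_derivative g' \<theta>) (at \<theta>)) \<and>
             (g' has_real_derivative D) (at 0) \<and> 0 < D)"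

text \<open>The PVM is given through a basis of unit vectors. Changing their phases changes \<open>\<phi>\<close>
  but not the resulting curve of PVMs.\<close>

definition admits_two_level_increase ::
    "real \<Rightarrow> complex^'d^'d \<Rightarrow> complex^'d^'d \<Rightarrow> ('d \<Rightarrow> complex^'d) \<Rightarrow> bool" where
  "admits_two_level_increase \<alpha> \<rho> \<sigma> b \<longleftrightarrow>
     (\<exists>j k t a. j \<noteq> k \<and>
        outcome_prob \<rho> (ket_bra (b j)) / outcome_prob \<sigma> (ket_bra (b j)) = t \<and>
        outcome_prob \<rho> (ket_bra (b k)) / outcome_prob \<sigma> (ket_bra (b k)) = t \<and>
        a = cinner (b j) ((\<rho> - t *\<^sub>R \<sigma>) *v b k) \<and> a \<noteq> 0 \<and>
        has_pos_second_derivative_at_0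
          (\<lambda>\<theta>. pvm_divergence \<alpha> \<rho> \<sigma> (pvm_of_basis (two_level_rotation b j k (- Arg a) \<theta>))))"

end

(* With x_j = p_j / q_j and w_j = x_j^\<alpha>, the divergence is an increasing function of
   \<Sum>_j (p_j U(x_j) - q_j w_j), where U(x) = \<alpha> x^(\<alpha> - 1) / (\<alpha> - 1), or ln x + 1 for \<alpha> = 1, is chosen so that
   p U(p/q) - q (p/q)^\<alpha> has partial derivatives U(p/q) and -(p/q)^\<alpha>.
   Criticality says (U(x_j) - U(x_k)) \<rho>_jk = (w_j - w_k) \<sigma>_jk. Along a two-level rotation between equal
   ratios t the second derivative is a positive multiple of |\<rho>_jk - t \<sigma>_jk|^2, so if no such direction
   increases the divergence, then \<sigma>_jk = \<psi>[w_j, w_k] \<rho>_jk for all j, k, with the divided difference of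
   \<psi>(w) = w^s / s and s = 1 - 1/\<alpha> (\<psi> = ln + 1 for \<alpha> = 1); note U(x) = \<psi>(x^\<alpha>). The operator
   \<Lambda> = \<Sum>_j (U(x_j) \<rho> - w_j \<sigma>) P_j is then a dual certificate: \<Lambda> \<ge> U(c) \<rho> - c^\<alpha> \<sigma> for all c > 0, because
   in the basis of P the difference is the Schur product of \<rho> with a kernel that for -1 \<le> s < 1 is a
   mixture of rank-one kernels coming from the resolvents 1/(w + l). Pairing \<Lambda> with a POVM bounds its
   divergence. For \<alpha> < 1/2 one exchanges \<rho> with \<sigma> and \<alpha> with 1 - \<alpha>. The Hessian at a critical point
   is compared with the second derivative along a two-level rotation. *)

theory Submission
  imports Defs
begin

section \<open>Linear algebra\<close>

text \<open>The range of s has an analytic origin: the integral of l^s / ((a + l)(b + l)) over l > 0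
  converges at 0 only for s > -1 and at infinity only for s < 1. With s = 1 - 1/\<alpha> the second
  bound always holds, the bound s \<ge> -1 only for \<alpha> \<ge> 1/2. The endpoint s = -1 and the
  value s = 0, where w^s / s degenerates, are reached by continuity in s of a finite quadratic form.
  The certificate is tight by construction: p U(p/q) - q (p/q)^\<alpha> is homogeneous of degree
  one, so it is recovered from its partial derivatives by Euler's identity, and the trace of
  \<Lambda> is exactly the sum belonging to P. An outcome of a POVM with ratio c = p/q is compared
  with the tangent functional at that c; since any c > 0 can occur, feasibility is demanded for all
  of them. Criticality by itself says nothing about pairs with equal ratio, where both sides of its
  equation vanish. This is the gap that the second-order information closes.\<close>

lemma cinner_add_right: "cinner u (v + w) = cinner u v + cinner u w"
  by (simp add: cinner_def algebra_simps sum.distrib)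

lemma cinner_diff_right: "cinner u (v - w) = cinner u v - cinner u w"
  by (simp add: cinner_def algebra_simps sum_subtractf)

lemma cinner_scale_right: "cinner u (c *s v) = c * cinner u v"
  by (simp add: cinner_def sum_distrib_left mult_ac)

lemma cinner_scaleR_right: "cinner u (r *\<^sub>R v) = of_real r * cinner u v"
  by (simp add: cinner_def sum_distrib_left scaleR_conv_of_real[where 'a=complex] mult_ac)

lemma cinner_zero_right [simp]: "cinner u 0 = 0"
  by (simp add: cinner_def)

lemma cinner_sum_right: "cinner u (\<Sum>j\<in>S. f j) = (\<Sum>j\<in>S. cinner u (f j))"
  by (induction S rule: infinite_finite_induct) (auto simp: cinner_add_right)

lemma cnj_cinner: "cnj (cinner v w) = cinner w v"
  by (simp add: cinner_def mult.commute)

lemma cinner_add_left: "cinner (u + v) w = cinner u w + cinner v w"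
  by (simp add: cinner_def algebra_simps sum.distrib)

lemma cinner_diff_left: "cinner (u - v) w = cinner u w - cinner v w"
  by (simp add: cinner_def algebra_simps sum_subtractf)

lemma cinner_scale_left: "cinner (c *s u) v = cnj c * cinner u v"
  by (simp add: cinner_def sum_distrib_left mult_ac)

lemma cinner_zero_left [simp]: "cinner 0 u = 0"
  by (simp add: cinner_def)

lemma cinner_sum_left: "cinner (\<Sum>j\<in>S. f j) u = (\<Sum>j\<in>S. cinner (f j) u)"
  by (induction S rule: infinite_finite_induct) (auto simp: cinner_add_left)

lemma cinner_mult_vec:
  "cinner u (A *v w) = (\<Sum>i\<in>UNIV. \<Sum>j\<in>UNIV. cnj (u $ i) * A $ i $ j * w $ j)"
  by (simp add: cinner_def matrix_vector_mult_def sum_distrib_left mult_ac)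

lemma mult_vec_scale: "A *v (c *s v) = c *s (A *v v)" for A :: "complex^'d^'d"
  by (simp add: vec_eq_iff matrix_vector_mult_def sum_distrib_left mult_ac)

lemma mult_vec_sum: "A *v (\<Sum>j\<in>S. f j) = (\<Sum>j\<in>S. A *v f j)" for A :: "complex^'d^'d"
  by (induction S rule: infinite_finite_induct) (auto simp: matrix_vector_right_distrib)

lemma mult_vec_sum_left: "(\<Sum>j\<in>S. f j) *v v = (\<Sum>j\<in>S. f j *v v)" for v :: "complex^'d"
  by (induction S rule: infinite_finite_induct) (simp_all add: matrix_vector_mult_add_rdistrib)

lemma scaleR_mult_vec: "(r *\<^sub>R A) *v v = r *\<^sub>R (A *v v)" for A :: "complex^'d^'d"
  by (simp add: vec_eq_iff matrix_vector_mult_def scaleR_sum_right)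

lemma hermitian_nth: "hermitian A \<Longrightarrow> cnj (A $ i $ j) = A $ j $ i"
  unfolding hermitian_def adjoint_mat_def vec_eq_iff by simp

lemma hermitianI: "(\<And>i j. cnj (A $ i $ j) = A $ j $ i) \<Longrightarrow> hermitian A"
  unfolding hermitian_def adjoint_mat_def vec_eq_iff by simp

lemma hermitian_cinner: "hermitian A \<Longrightarrow> cnj (cinner u (A *v w)) = cinner w (A *v u)"
  unfolding cinner_mult_vec cnj_sum
  by (subst sum.swap) (auto intro!: sum.cong simp: hermitian_nth mult_ac)

lemma ket_bra_mult_vec: "ket_bra v *v w = cinner v w *s v"
  by (simp add: vec_eq_iff ket_bra_def matrix_vector_mult_def cinner_def sum_distrib_left mult_ac)

lemma trace_mult_ket_bra: "trace (A ** ket_bra v) = cinner v (A *v v)"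
  by (simp add: cinner_mult_vec trace_def matrix_matrix_mult_def ket_bra_def mult_ac)

lemma outcome_prob_ket_bra: "outcome_prob A (ket_bra v) = Re (cinner v (A *v v))"
  by (simp add: outcome_prob_def trace_mult_ket_bra)

lemma matrix_mult_distrib_right: "(A + B) ** C = A ** C + B ** C" for A :: "complex^'n^'m"
  by (simp add: vec_eq_iff matrix_matrix_mult_def algebra_simps sum.distrib)

lemma matrix_mult_sum_right: "A ** (\<Sum>j\<in>S. f j) = (\<Sum>j\<in>S. A ** f j)"
  for A :: "complex^'d^'d"
  by (induction S rule: infinite_finite_induct) (auto simp: matrix_add_ldistrib)

lemma matrix_mult_sum_left: "(\<Sum>j\<in>S. f j) ** A = (\<Sum>j\<in>S. f j ** A)"
  for A :: "complex^'d^'d"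
  by (induction S rule: infinite_finite_induct) (simp_all add: matrix_mult_distrib_right)

lemma trace_sum: "trace (\<Sum>j\<in>S. f j) = (\<Sum>j\<in>S. trace (f j))"
  for f :: "_ \<Rightarrow> complex^'d^'d"
  by (induction S rule: infinite_finite_induct) (auto simp: trace_add trace_0[unfolded mat_0] )

lemma trace_scaleR: "trace (r *\<^sub>R A) = of_real r * trace A" for A :: "complex^'d^'d"
  by (simp add: trace_def sum_distrib_left scaleR_conv_of_real[where 'a=complex])

lemma scaleR_matrix_mult: "(r *\<^sub>R A) ** B = r *\<^sub>R (A ** B)" "A ** (r *\<^sub>R B) = r *\<^sub>R (A ** B)"
  for A B :: "complex^'d^'d"
  by (simp_all add: vec_eq_iff matrix_matrix_mult_def scaleR_sum_right)

lemma outcome_prob_sum: "outcome_prob A (\<Sum>j\<in>S. f j) = (\<Sum>j\<in>S. outcome_prob A (f j))"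
  by (simp add: outcome_prob_def matrix_mult_sum_right trace_sum)

lemma outcome_prob_add_left: "outcome_prob (A + B) E = outcome_prob A E + outcome_prob B E"
  by (simp add: outcome_prob_def matrix_mult_distrib_right trace_add)

lemma outcome_prob_scaleR_left: "outcome_prob (r *\<^sub>R A) E = r * outcome_prob A E"
  by (simp add: outcome_prob_def scaleR_matrix_mult trace_scaleR)

lemma outcome_prob_sum_left: "outcome_prob (\<Sum>j\<in>S. f j) E = (\<Sum>j\<in>S. outcome_prob (f j) E)"
  by (simp add: outcome_prob_def matrix_mult_sum_left trace_sum)

lemma outcome_prob_diff_left: "outcome_prob (A - B) E = outcome_prob A E - outcome_prob B E"
  using outcome_prob_add_left[of "A - B" B E] by simp

lemma outcome_prob_mat_1: "outcome_prob A (mat 1) = Re (trace A)"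
  by (simp add: outcome_prob_def)

text \<open>Orthonormality makes the matrix \<open>C\<close> of bras a left inverse of the matrix
  \<open>B\<close> of kets. For square matrices it is then also a right inverse, which is
  completeness.\<close>

lemma orthonormal_basis_matrix:
  fixes b :: "'d \<Rightarrow> complex^'d"
  assumes "orthonormal_basis b"
  shows "(\<Sum>j\<in>UNIV. ket_bra (b j)) = mat 1"
proof -
  define B :: "complex^'d^'d" where "B = (\<chi> i j. b j $ i)"
  define C :: "complex^'d^'d" where "C = (\<chi> i j. cnj (b i $ j))"
  have "C ** B = mat 1"
    using assms by (simp add: vec_eq_iff orthonormal_basis_def cinner_def B_def C_def
        matrix_matrix_mult_def mat_def)
  hence "B ** C = mat 1"
    by (simp add: matrix_left_right_inverse)
  thus ?thesis
    by (simp add: vec_eq_iff B_def C_def matrix_matrix_mult_def ket_bra_def)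
qed

lemma orthonormal_expansion:
  assumes "orthonormal_basis b"
  shows "v = (\<Sum>j\<in>UNIV. cinner (b j) v *s b j)"
proof -
  have "v = (\<Sum>j\<in>UNIV. ket_bra (b j)) *v v"
    by (simp add: orthonormal_basis_matrix[OF assms])
  also have "\<dots> = (\<Sum>j\<in>UNIV. ket_bra (b j) *v v)"
    by (simp add: mult_vec_sum_left)
  finally show ?thesis by (simp add: ket_bra_mult_vec)
qed

section \<open>Positive semidefinite matrices as sums of rank-one matrices\<close>

lemma pos_semidef_ket_bra: "pos_semidef (ket_bra v)"
proof -
  have "0 \<le> Re (cinner w (ket_bra v *v w))" for w
  proof -
    have "cinner w (ket_bra v *v w) = cinner v w * cnj (cinner v w)"
      by (simp add: ket_bra_mult_vec cinner_scale_right cnj_cinner)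
    thus ?thesis by (simp add: complex_mult_cnj)
  qed
  moreover have "hermitian (ket_bra v)"
    by (rule hermitianI) (simp add: ket_bra_def mult.commute)
  ultimately show ?thesis by (simp add: pos_semidef_def)
qed

lemma pos_semidef_form_real:
  assumes "hermitian A"
  shows "Im (cinner v (A *v v)) = 0"
  using arg_cong[OF hermitian_cinner[OF assms, of v v], of Im] by simp

lemma mult_axis: "A *v axis i 1 = column i A" for A :: "complex^'d^'d"
  by (simp add: vec_eq_iff matrix_vector_mult_def axis_def column_def if_distrib[of "\<lambda>x. _ * x"]
      cong: if_cong)

lemma cinner_axis: "cinner (axis i 1) v = v $ i"
  by (simp add: cinner_def axis_def if_distrib[of cnj] if_distrib[of "\<lambda>x. x * _"] cong: if_cong)

lemma pos_semidef_diag: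
  assumes "pos_semidef A"
  shows "0 \<le> Re (A $ i $ i)" "Im (A $ i $ i) = 0"
proof -
  have "cinner (axis i 1) (A *v axis i 1) = A $ i $ i"
    by (simp add: cinner_axis mult_axis column_def)
  thus "0 \<le> Re (A $ i $ i)" "Im (A $ i $ i) = 0"
    using assms pos_semidef_form_real[of A "axis i 1"] unfolding pos_semidef_def by metis+
qed

lemma pos_semidef_zero_diag:
  assumes "pos_semidef A" "\<And>i. A $ i $ i = 0"
  shows "A = 0"
proof -
  have "A $ i $ j = 0" for i j
  proof -
    \<comment> \<open>On \<open>axis i 1 + c *s axis j 1\<close> both diagonal terms vanish, so the
      form is real-linear in \<open>c\<close>; this choice makes it -2 |A_ij|^2.\<close>
    define c where "c = - cnj (A $ i $ j)"
    have "0 \<le> Re (cinner (axis i 1 + c *s axis j 1) (A *v (axis i 1 + c *s axis j 1)))"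
      using assms(1) by (simp add: pos_semidef_def)
    also have "cinner (axis i 1 + c *s axis j 1) (A *v (axis i 1 + c *s axis j 1)) =
        c * A $ i $ j + cnj c * A $ j $ i"
      by (simp add: cinner_add_left cinner_add_right matrix_vector_right_distrib mult_vec_scale
          cinner_scale_left cinner_scale_right cinner_axis mult_axis column_def assms(2))
    also have "A $ j $ i = cnj (A $ i $ j)"
      using assms(1) by (simp add: pos_semidef_def hermitian_nth)
    also have "Re (c * A $ i $ j + cnj c * cnj (A $ i $ j)) = - 2 * (cmod (A $ i $ j))\<^sup>2"
      by (simp add: c_def cmod_power2) (simp add: power2_eq_square)
    finally show ?thesis by simp
  qed
  thus ?thesis by (simp add: vec_eq_iff)
qed

text \<open>A Cholesky step: subtracting \<open>|v\<rangle>\<langle>v|\<close> with \<open>v = A e\<^sub>i / sqrt A\<^sub>i\<^sub>i\<close> annihilates the \<open>i\<close>-th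
  diagonal entry, and the new quadratic form at \<open>x\<close> is the old one at \<open>x - ((A x)\<^sub>i / A\<^sub>i\<^sub>i) e\<^sub>i\<close>.\<close>

lemma pos_semidef_eliminate:
  assumes A: "pos_semidef A" and i: "A $ i $ i \<noteq> 0"
  obtains v where "pos_semidef (A - ket_bra v)" "(A - ket_bra v) $ i $ i = 0"
proof -
  define a where "a = Re (A $ i $ i)"
  have Aii: "A $ i $ i = of_real a" and a: "a > 0"
    using pos_semidef_diag[OF A, of i] i by (auto simp: a_def complex_eq_iff)
  have H: "hermitian A" using A by (simp add: pos_semidef_def)
  define v where "v = of_real (1 / sqrt a) *s (A *v axis i 1)"
  have vn: "v $ r = of_real (1 / sqrt a) * A $ r $ i" for r
    by (simp add: v_def mult_axis column_def)
  have sq: "complex_of_real (sqrt a) * complex_of_real (sqrt a) = of_real a"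
    using a by (simp flip: of_real_mult)
  have kb: "(A - ket_bra v) $ r $ s = A $ r $ s - A $ r $ i * A $ i $ s / a" for r s
    using sq a by (simp add: ket_bra_def vn hermitian_nth[OF H] field_simps)
  have "(A - ket_bra v) $ i $ i = 0"
    using a by (simp add: kb Aii del: vector_minus_component)
  moreover have "pos_semidef (A - ket_bra v)"
    unfolding pos_semidef_def
  proof safe
    show "hermitian (A - ket_bra v)"
      using H pos_semidef_ket_bra[of v]
      by (auto intro!: hermitianI simp: hermitian_nth pos_semidef_def)
    fix x
    define c where "c = - ((A *v x) $ i / of_real a)"
    have col: "cinner x (A *v axis i 1) = cnj ((A *v x) $ i)"
      using hermitian_cinner[OF H, of "axis i 1" x] by (simp add: cinner_axis)
    have "0 \<le> Re (cinner (x + c *s axis i 1) (A *v (x + c *s axis i 1)))"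
      using A by (simp add: pos_semidef_def)
    also have "cinner (x + c *s axis i 1) (A *v (x + c *s axis i 1)) =
        cinner x (A *v x) + c * cnj ((A *v x) $ i) + cnj c * (A *v x) $ i + cnj c * c * of_real a"
      using Aii
      by (simp add: cinner_add_left cinner_add_right matrix_vector_right_distrib mult_vec_scale
          cinner_scale_left cinner_scale_right cinner_axis col)
         (simp add: mult_axis column_def algebra_simps)
    also have "\<dots> = cinner x (A *v x) - (A *v x) $ i * cnj ((A *v x) $ i) / of_real a"
      using a by (simp add: c_def field_simps)
    also have "\<dots> = cinner x ((A - ket_bra v) *v x)"
    proof -
      have "cinner v x = of_real (1 / sqrt a) * (A *v x) $ i"
        using cnj_cinner[of x "A *v axis i 1"] by (simp add: v_def cinner_scale_left col)
      moreover have "cinner x v = of_real (1 / sqrt a) * cnj ((A *v x) $ i)"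
        by (simp add: v_def cinner_scale_right col)
      ultimately have "cinner v x * cinner x v = (A *v x) $ i * cnj ((A *v x) $ i) / of_real a"
        using a by (simp add: mult_ac) (simp add: sq mult.assoc[symmetric])
      thus ?thesis
        by (simp add: matrix_vector_mult_diff_rdistrib cinner_diff_right ket_bra_mult_vec
            cinner_scale_right)
    qed
    finally show "0 \<le> Re (cinner x ((A - ket_bra v) *v x))" .
  qed
  ultimately show ?thesis using that by blast
qed

text \<open>Induction on the number of nonzero diagonal entries, each elimination removing at least
  one. No eigenvectors are involved, and traces against \<open>A\<close> become sums of quadratic
  forms.\<close>

lemma pos_semidef_decomposition:
  assumes "pos_semidef A"
  shows "\<exists>n v. A = (\<Sum>m<n::nat. ket_bra (v m))"
  using assms
proof (induction "card {i. A $ i $ i \<noteq> 0}" arbitrary: A rule: less_induct)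
  case less
  show ?case
  proof (cases "\<exists>i. A $ i $ i \<noteq> 0")
    case False
    hence "A = 0" using pos_semidef_zero_diag less.prems by blast
    thus ?thesis by (auto intro!: exI[of _ 0])
  next
    case True
    then obtain i where i: "A $ i $ i \<noteq> 0" by blast
    from pos_semidef_eliminate[OF less.prems i] obtain u
      where u: "pos_semidef (A - ket_bra u)" "(A - ket_bra u) $ i $ i = 0" .
    \<comment> \<open>A vanishing diagonal entry turns into -|u_j|^2, which positivity of the
      remainder forces to be 0. Hence no index re-enters the count.\<close>
    have "(A - ket_bra u) $ j $ j = 0" if "A $ j $ j = 0" for j
      using pos_semidef_diag[OF u(1), of j] that
      by (auto simp: ket_bra_def complex_mult_cnj complex_eq_iff) (use sum_power2_ge_zero[of "Re (u $ j)" "Im (u $ j)"] in linarith)+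
    hence "{j. (A - ket_bra u) $ j $ j \<noteq> 0} \<subset> {j. A $ j $ j \<noteq> 0}"
      using i u(2) by blast
    hence "card {j. (A - ket_bra u) $ j $ j \<noteq> 0} < card {j. A $ j $ j \<noteq> 0}"
      by (intro psubset_card_mono) auto
    from less.hyps[OF this u(1)] obtain n v where "A - ket_bra u = (\<Sum>m<n::nat. ket_bra (v m))"
      by blast
    hence "A = (\<Sum>m<Suc n. ket_bra ((v(n := u)) m))"
      by (simp add: algebra_simps)
    thus ?thesis by blast
  qed
qed

text \<open>The assumption on \<open>X\<close> concerns only the real part of its form, because it
  will be applied to differences with \<open>dual_operator\<close>, a sum of products that is not
  visibly Hermitian.\<close>

lemma outcome_prob_nonneg:
  assumes "pos_semidef E" "\<And>v. 0 \<le> Re (cinner v (X *v v))"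
  shows "0 \<le> outcome_prob X E"
proof -
  obtain n v where "E = (\<Sum>m<n::nat. ket_bra (v m))"
    using pos_semidef_decomposition[OF assms(1)] by blast
  thus ?thesis using assms(2) by (auto simp: outcome_prob_sum outcome_prob_ket_bra intro!: sum_nonneg)
qed

lemma outcome_prob_pos:
  assumes "pos_semidef E" "E \<noteq> 0" "pos_def \<rho>"
  shows "0 < outcome_prob \<rho> E"
proof -
  obtain n v where E: "E = (\<Sum>m<n::nat. ket_bra (v m))"
    using pos_semidef_decomposition[OF assms(1)] by blast
  have nn: "0 \<le> Re (cinner u (\<rho> *v u))" for u
    using assms(3) by (cases "u = 0") (auto simp: pos_def_def less_imp_le)
  obtain m where m: "m < n" "v m \<noteq> 0"
  proof (rule ccontr)
    assume "\<not> thesis"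
    hence "\<forall>m<n. v m = 0" using that by blast
    hence "E = 0" by (auto simp: E ket_bra_def vec_eq_iff)
    thus False using assms by simp
  qed
  hence "0 < Re (cinner (v m) (\<rho> *v v m))"
    using assms(3) by (simp add: pos_def_def)
  thus ?thesis
    using m nn by (auto simp: E outcome_prob_sum outcome_prob_ket_bra intro!: sum_pos2[of _ m])
qed

section \<open>Divided differences of powers\<close>

text \<open>An antiderivative of w^(s - 1). The \<open>+ 1\<close> at s = 0 cancels in every
  difference and serves only to match \<open>div_slope\<close> at \<alpha> = 1.\<close>

definition pow_prim :: "real \<Rightarrow> real \<Rightarrow> real" where
  "pow_prim s w = (if s = 0 then ln w + 1 else w powr s / s)"

definition pow_dd :: "real \<Rightarrow> real \<Rightarrow> real \<Rightarrow> real" where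
  "pow_dd s a b = (if a = b then a powr (s - 1) else (pow_prim s a - pow_prim s b) / (a - b))"

text \<open>The factor 1 / ((a + l)(b + l)) is minus the divided difference at a, b of the resolvent
  w -> 1 / (w + l). Integration against l^s produces a multiple of the divided difference of w^s /
  s.\<close>

definition res_integrand :: "real \<Rightarrow> real \<Rightarrow> real \<Rightarrow> real \<Rightarrow> real" where
  "res_integrand s a b l = indicator {0<..} l * (l powr s / ((a + l) * (b + l)))"

definition res_kernel :: "real \<Rightarrow> real \<Rightarrow> real \<Rightarrow> real" where
  "res_kernel s a b = (LINT l|lborel. res_integrand s a b l)"

lemma res_integrand_measurable [measurable]: "res_integrand s a b \<in> borel_measurable borel"
  unfolding res_integrand_def by measurable

text \<open>A bridge from gauge integrals of powers to Lebesgue integrability: non-negativity gives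
  absolute integrability for the completed measure, and Borel measurability brings it down to
  \<open>lborel\<close>.\<close>

lemma integrable_lborel_of_has_integral:
  fixes f :: "real \<Rightarrow> real"
  assumes "(f has_integral I) S" "\<And>x. x \<in> S \<Longrightarrow> 0 \<le> f x"
    and [measurable]: "f \<in> borel_measurable borel" "S \<in> sets borel"
  shows "integrable lborel (\<lambda>x. indicator S x * f x)"
proof -
  have "f absolutely_integrable_on S"
    using assms(1,2) by (intro nonnegative_absolutely_integrable_1) auto
  hence "integrable (completion lborel) (\<lambda>x. indicator S x * f x)"
    by (simp add: set_integrable_def)
  thus ?thesis
    by (subst (asm) integrable_completion) auto
qed

text \<open>The integrand is at most l^s / (a b) on (0, 1] and at most l^(s - 2) beyond 1; the first
  is integrable because s > -1, the second because s < 1.\<close>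

lemma res_integrand_integrable:
  assumes s: "-1 < s" "s < 1" and a: "a > 0" and b: "b > 0"
  shows "integrable lborel (res_integrand s a b)"
proof (rule Bochner_Integration.integrable_bound)
  let ?g = "\<lambda>l::real. indicator {0..1} l * l powr s * (1 / (a * b)) + indicator {1..} l * l powr (s - 2)"
  show "integrable lborel ?g"
    using s
    by (intro Bochner_Integration.integrable_add integrable_mult_left
        integrable_lborel_of_has_integral[OF has_integral_powr_from_0]
        integrable_lborel_of_has_integral[OF has_integral_powr_to_inf]) auto
  show "AE l in lborel. norm (res_integrand s a b l) \<le> norm (?g l)"
  proof (rule AE_I2)
    fix l :: real
    have g: "0 \<le> ?g l" using a b by (auto simp: indicator_def)
    have "res_integrand s a b l \<le> ?g l"
    proof (cases "l \<le> 0")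
      case True
      thus ?thesis using g by (simp add: res_integrand_def)
    next
      case l: False
      show ?thesis
      proof (cases "l \<le> 1")
        case True
        have "l powr s / ((a + l) * (b + l)) \<le> l powr s / (a * b)"
          using a b l by (intro divide_left_mono mult_mono) auto
        thus ?thesis using l True a b by (auto simp: res_integrand_def indicator_def)
      next
        case False
        have "l powr s / ((a + l) * (b + l)) \<le> l powr s / (l * l)"
          using a b l by (intro divide_left_mono mult_mono) auto
        also have "\<dots> = l powr (s - 2)"
          using l by (simp add: powr_diff power2_eq_square)
        finally show ?thesis using l False by (simp add: res_integrand_def)
      qed
    qed
    moreover have "0 \<le> res_integrand s a b l"
      using a b by (auto simp: res_integrand_def indicator_def)
    ultimately show "norm (res_integrand s a b l) \<le> norm (?g l)"
      using g by simp
  qed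
qed auto

text \<open>Under the integral this is the resolvent identity (a - b) / ((a + l)(b + l)) = 1 / (b +
  l) - 1 / (a + l), whose right-hand side telescopes.\<close>

lemma res_kernel_cocycle:
  assumes s: "-1 < s" "s < 1" and pos: "a > 0" "b > 0" "c > 0"
  shows "(a - b) * res_kernel s a b + (b - c) * res_kernel s b c = (a - c) * res_kernel s a c"
proof -
  have "(a - b) * res_integrand s a b l + (b - c) * res_integrand s b c l
      = (a - c) * res_integrand s a c l" for l
  proof (cases "l > 0")
    case True
    hence "a + l \<noteq> 0" "b + l \<noteq> 0" "c + l \<noteq> 0" using pos by auto
    thus ?thesis using True by (simp add: res_integrand_def divide_simps) algebra
  qed (simp add: res_integrand_def)
  hence "(LINT l|lborel. (a - b) * res_integrand s a b l + (b - c) * res_integrand s b c l)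
      = (LINT l|lborel. (a - c) * res_integrand s a c l)" by presburger
  thus ?thesis
    using res_integrand_integrable[OF s] pos by (simp add: res_kernel_def)
qed

text \<open>Substituting t l for l contributes t^s from the power, t^(-2) from the two resolvents
  and t from the measure.\<close>

lemma res_kernel_scale:
  assumes "t > 0" "a > 0" "b > 0"
  shows "res_kernel s (t * a) (t * b) = t powr (s - 1) * res_kernel s a b"
proof -
  have "res_integrand s (t * a) (t * b) (0 + t * l) = t powr (s - 2) * res_integrand s a b l" for l
  proof (cases "l > 0")
    case True
    have "(t * a + t * l) * (t * b + t * l) = t\<^sup>2 * ((a + l) * (b + l))" by algebra
    thus ?thesis using True assms
      by (simp add: res_integrand_def powr_mult powr_diff)
  next
    case False
    hence "\<not> 0 < t * l" using assms by (simp add: zero_less_mult_iff)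
    thus ?thesis using False by (simp add: res_integrand_def)
  qed
  hence "res_kernel s (t * a) (t * b) = t * (t powr (s - 2) * res_kernel s a b)"
    unfolding res_kernel_def
    using assms by (subst lborel_integral_real_affine[of t _ 0]) auto
  moreover have "t * t powr (s - 2) = t powr (s - 1)"
    using assms powr_add[of t 1 "s - 2"] by simp
  ultimately show ?thesis by (metis mult.assoc)
qed

text \<open>Pointwise comparison of the integrands; the second bound uses (a + l) / (b + l) \<ge> a
  / b. Together they squeeze the kernel as b decreases to a, in place of a continuity theorem for
  the integral.\<close>

lemma res_kernel_mono:
  assumes s: "-1 < s" "s < 1" and pos: "0 < a" "a \<le> b"
  shows "res_kernel s a b \<le> res_kernel s a a" "a / b * res_kernel s a a \<le> res_kernel s a b"
proof -
  have "res_integrand s a b l \<le> res_integrand s a a l" for l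
    using pos by (auto simp: res_integrand_def indicator_def intro!: divide_left_mono mult_mono)
  thus "res_kernel s a b \<le> res_kernel s a a"
    unfolding res_kernel_def using res_integrand_integrable[OF s] pos
    by (intro integral_mono) auto
  have "a / b * res_integrand s a a l \<le> res_integrand s a b l" for l
  proof (cases "l > 0")
    case True
    have "0 \<le> (b - a) * l" using True pos by simp
    hence "a * (b + l) \<le> b * (a + l)" by (simp add: algebra_simps)
    hence "a / b / (a + l) \<le> 1 / (b + l)"
      using pos True by (simp add: divide_simps mult.commute)
    hence "l powr s / (a + l) * (a / b / (a + l)) \<le> l powr s / (a + l) * (1 / (b + l))"
      using pos True by (intro mult_left_mono) auto
    thus ?thesis using True by (simp add: res_integrand_def mult_ac)
  qed (simp add: res_integrand_def)
  hence "(LINT l|lborel. a / b * res_integrand s a a l) \<le> (LINT l|lborel. res_integrand s a b l)"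
    using res_integrand_integrable[OF s] pos by (intro integral_mono) auto
  thus "a / b * res_kernel s a a \<le> res_kernel s a b"
    using res_integrand_integrable[OF s] pos by (simp add: res_kernel_def)
qed

lemma res_kernel_pos:
  assumes s: "-1 < s" "s < 1" and pos: "0 < a" "0 < b"
  shows "0 < res_kernel s a b"
proof -
  \<comment> \<open>A lower bound of the integrand on [1, 2]: there l^s is at least 1 or at least
    2^s, depending on the sign of s.\<close>
  define m where "m = min 1 (2 powr s) / ((a + 2) * (b + 2))"
  have m: "m > 0" using pos by (simp add: m_def)
  have "indicator {1..2} l * m \<le> res_integrand s a b l" for l :: real
  proof (cases "1 \<le> l \<and> l \<le> 2")
    case True
    have "min 1 (2 powr s) \<le> l powr s"
    proof (cases "s \<ge> 0")
      case True
      thus ?thesis using \<open>1 \<le> l \<and> l \<le> 2\<close> ge_one_powr_ge_zero[of l s] by simp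
    next
      case False
      hence "2 powr s \<le> l powr s" using True by (intro powr_mono2') auto
      thus ?thesis by simp
    qed
    hence "m \<le> l powr s / ((a + l) * (b + l))"
      unfolding m_def using True pos by (intro frac_le mult_mono mult_pos_pos) auto
    thus ?thesis using True by (simp add: res_integrand_def)
  next
    case False
    thus ?thesis using pos by (auto simp: res_integrand_def indicator_def)
  qed
  moreover have "integrable lborel (\<lambda>l. indicator {1..2::real} l * m)"
    by (intro integrable_mult_left integrable_real_indicator) auto
  ultimately have "(LINT l|lborel. indicator {1..2::real} l * m) \<le> res_kernel s a b"
    unfolding res_kernel_def by (intro integral_mono res_integrand_integrable s pos) auto
  thus ?thesis using m by simp
qed

text \<open>By scaling, \<open>G a = (a - 1) * res_kernel s a 1\<close> satisfies \<open>G (a b) = b\<^sup>s G a + G b\<close>. Since the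
  left-hand side is symmetric, \<open>G\<close> is a multiple of \<open>a\<^sup>s - 1\<close>, so no explicit integral is needed.\<close>

lemma res_kernel_pow_dd:
  assumes s: "-1 < s" "s < 1" "s \<noteq> 0"
  obtains C where "C > 0" "\<And>a b. a > 0 \<Longrightarrow> b > 0 \<Longrightarrow> res_kernel s a b = C * pow_dd s a b"
proof -
  define G where "G = (\<lambda>a. (a - 1) * res_kernel s a 1)"
  have G: "(a - b) * res_kernel s a b = G a - G b" if "a > 0" "b > 0" for a b
    using res_kernel_cocycle[OF s(1,2) that, of 1] by (simp add: G_def)
  have mult: "G (a * b) = b powr s * G a + G b" if "a > 0" "b > 0" for a b
  proof -
    have "G (a * b) - G b = (a * b - b) * res_kernel s (a * b) b"
      using that by (subst G) auto
    also have "\<dots> = (a * b - b) * (b powr (s - 1) * res_kernel s a 1)"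
      using res_kernel_scale[of b a 1 s] that by (simp add: mult.commute)
    also have "\<dots> = b powr s * G a"
      using that by (simp add: G_def powr_diff field_simps)
    finally show ?thesis by simp
  qed
  \<comment> \<open>Exchanging the roles of \<open>a\<close> and 2 in \<open>mult\<close> gives (2^s
    - 1) G a = (a^s - 1) G 2, so the value at 2 fixes the factor.\<close>
  define D where "D = G 2 / (2 powr s - 1)"
  have two: "(2::real) powr s \<noteq> 1" using s by simp
  have GD: "G a = D * (a powr s - 1)" if "a > 0" for a
    using mult[of a 2] mult[of 2 a] that two by (simp add: D_def field_simps)
  define C where "C = D * s"
  have "1 < (2::real) powr s \<longleftrightarrow> 0 < s" "(2::real) powr s < 1 \<longleftrightarrow> s < 0"
    using powr_less_cancel_iff[of 2 0 s] powr_less_cancel_iff[of 2 s 0] by simp_all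
  hence "C > 0"
    using res_kernel_pos[OF s(1,2), of 2 1] two s(3)
    by (auto simp: C_def D_def G_def zero_less_divide_iff zero_less_mult_iff mult_less_0_iff)
  have ne: "res_kernel s a b = C * pow_dd s a b" if "a > 0" "b > 0" "a \<noteq> b" for a b
  proof -
    have "(a - b) * res_kernel s a b = D * (a powr s - b powr s)"
      using G[OF that(1,2)] GD that by (simp add: algebra_simps)
    moreover have "C * pow_dd s a b = D * (a powr s - b powr s) / (a - b)"
      using that s by (simp add: pow_dd_def pow_prim_def C_def diff_divide_distrib[symmetric])
    hence "(a - b) * (C * pow_dd s a b) = D * (a powr s - b powr s)"
      using that by simp
    ultimately show ?thesis using that by (metis mult_left_cancel right_minus_eq)
  qed
  \<comment> \<open>On the diagonal the cocycle identity is empty. The off-diagonal formula is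
    passed to the limit b -> a from the right, where the divided difference tends to the derivative
    and the kernel is squeezed.\<close>
  have eq: "res_kernel s a a = C * pow_dd s a a" if a: "a > 0" for a
  proof -
    have "((\<lambda>w. w powr s / s) has_real_derivative a powr (s - 1)) (at a)"
      using a s by (auto intro!: derivative_eq_intros)
    hence "((\<lambda>b. (b powr s / s - a powr s / s) / (b - a)) \<longlongrightarrow> a powr (s - 1)) (at_right a)"
      unfolding has_field_derivative_iff by (rule filterlim_mono) (auto simp: at_le)
    moreover have "\<forall>\<^sub>F b in at_right a. (b powr s / s - a powr s / s) / (b - a) = pow_dd s a b"
      using eventually_at_right_less[of a]
      by eventually_elim (use s in \<open>auto simp: pow_dd_def pow_prim_def field_simps\<close>)
    ultimately have "(pow_dd s a \<longlongrightarrow> a powr (s - 1)) (at_right a)"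
      using tendsto_cong by fast
    hence lim: "((\<lambda>b. C * pow_dd s a b) \<longlongrightarrow> C * pow_dd s a a) (at_right a)"
      using tendsto_mult_left[of "pow_dd s a" "a powr (s - 1)" _ C] by (simp add: pow_dd_def[of _ a a])
    have ev: "\<forall>\<^sub>F b in at_right a. b > a" by (rule eventually_at_right_less)
    have "C * pow_dd s a a \<le> res_kernel s a a"
    proof (rule tendsto_upperbound[OF lim])
      show "\<forall>\<^sub>F b in at_right a. C * pow_dd s a b \<le> res_kernel s a a"
        using ev by eventually_elim (use a res_kernel_mono(1)[OF s(1,2) a] in \<open>auto simp flip: ne\<close>)
    qed auto
    moreover have "a / a * res_kernel s a a \<le> C * pow_dd s a a"
    proof (rule tendsto_le[OF _ lim])
      show "((\<lambda>b. a / b * res_kernel s a a) \<longlongrightarrow> a / a * res_kernel s a a) (at_right a)"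
        using a by (intro tendsto_intros) auto
      show "\<forall>\<^sub>F b in at_right a. a / b * res_kernel s a a \<le> C * pow_dd s a b"
        using ev by eventually_elim (use a res_kernel_mono(2)[OF s(1,2) a] in \<open>auto simp flip: ne\<close>)
    qed auto
    ultimately show ?thesis using a by simp
  qed
  show ?thesis
    using that[OF \<open>C > 0\<close>] ne eq by metis
qed

text \<open>This is (a - c) times the difference of the divided differences at (a, c) and at (a, b),
  that is, -(a - c)(b - c) times the second divided difference of \<open>pow_prim s\<close>. Hence
  it is symmetric in \<open>a\<close> and \<open>b\<close>, although the formula is not. The
  arguments are on the scale of w = x^\<alpha>.\<close>

definition loewner_entry :: "real \<Rightarrow> real \<Rightarrow> real \<Rightarrow> real \<Rightarrow> real" where
  "loewner_entry s c a b = pow_prim s a - pow_prim s c - (a - c) * pow_dd s a b"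

text \<open>Up to the constant \<open>C\<close>, each entry is an integral over l of a nonnegative
  weight times g_j g_k with g_j = (w_j - c) / (w_j + l). For fixed l the form is therefore the form
  of \<open>R\<close> at the rescaled vector z_j g_j.\<close>

lemma loewner_form_nonneg_nonzero:
  fixes R :: "'i::finite \<Rightarrow> 'i \<Rightarrow> complex" and w :: "'i \<Rightarrow> real"
  assumes s: "-1 < s" "s < 1" "s \<noteq> 0"
    and R: "\<And>y. 0 \<le> Re (\<Sum>j\<in>UNIV. \<Sum>k\<in>UNIV. cnj (y k) * y j * R k j)"
    and w: "\<And>j. w j > 0" and c: "c > 0"
  shows "0 \<le> (\<Sum>j\<in>UNIV. \<Sum>k\<in>UNIV. Re (cnj (z k) * z j * R k j) * loewner_entry s c (w j) (w k))"
proof -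
  obtain C where C: "C > 0" "\<And>a b. a > 0 \<Longrightarrow> b > 0 \<Longrightarrow> res_kernel s a b = C * pow_dd s a b"
    using res_kernel_pow_dd[OF s] by blast
  define h where "h j k l = (w j - c) * res_integrand s (w j) c l
    - (w j - c) * res_integrand s (w j) (w k) l" for j k l
  have hint: "integrable lborel (h j k)" for j k
    unfolding h_def using w c
    by (intro Bochner_Integration.integrable_diff integrable_mult_right res_integrand_integrable s)
  have hL: "(LINT l|lborel. h j k l) = C * loewner_entry s c (w j) (w k)" for j k
  proof -
    have "(LINT l|lborel. h j k l) = (w j - c) * res_kernel s (w j) c - (w j - c) * res_kernel s (w j) (w k)"
      unfolding h_def res_kernel_def using w c
      by (subst Bochner_Integration.integral_diff) (auto intro!: integrable_mult_right res_integrand_integrable s)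
    also have "\<dots> = C * ((w j - c) * pow_dd s (w j) c - (w j - c) * pow_dd s (w j) (w k))"
      using C(2) w c by (simp add: algebra_simps)
    also have "(w j - c) * pow_dd s (w j) c = pow_prim s (w j) - pow_prim s c"
      by (simp add: pow_dd_def)
    finally show ?thesis by (simp add: loewner_entry_def)
  qed
  have "0 \<le> (\<Sum>j\<in>UNIV. \<Sum>k\<in>UNIV. Re (cnj (z k) * z j * R k j) * h j k l)" for l
  proof (cases "l > 0")
    case True
    define y where "y j = z j * of_real ((w j - c) / (w j + l))" for j
    \<comment> \<open>Here 1 / (c + l) - 1 / (w_k + l) = (w_k - c) / ((c + l)(w_k + l)), which turns
      the difference in \<open>h\<close> into a rank-one product.\<close>
    have hl: "h j k l = l powr s / (c + l) * ((w j - c) / (w j + l) * ((w k - c) / (w k + l)))" for j k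
    proof -
      have "w j + l \<noteq> 0" "w k + l \<noteq> 0" "c + l \<noteq> 0" using True w[of j] w[of k] c by auto
      thus ?thesis using True by (simp add: h_def res_integrand_def divide_simps) algebra
    qed
    have "Re (cnj (z k) * z j * R k j) * h j k l
        = l powr s / (c + l) * Re (cnj (y k) * y j * R k j)" for j k
    proof -
      have "cnj (y k) * y j * R k j = of_real ((w j - c) / (w j + l) * ((w k - c) / (w k + l)))
          * (cnj (z k) * z j * R k j)"
        by (simp only: y_def of_real_mult complex_cnj_mult complex_cnj_complex_of_real mult_ac)
      moreover have "Re (of_real r * x) = r * Re x" for r x by simp
      ultimately have "Re (cnj (y k) * y j * R k j) = (w j - c) / (w j + l) * ((w k - c) / (w k + l))
          * Re (cnj (z k) * z j * R k j)" by (simp only:)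
      thus ?thesis unfolding hl by (simp only: mult_ac)
    qed
    hence "(\<Sum>j\<in>UNIV. \<Sum>k\<in>UNIV. Re (cnj (z k) * z j * R k j) * h j k l)
        = l powr s / (c + l) * Re (\<Sum>j\<in>UNIV. \<Sum>k\<in>UNIV. cnj (y k) * y j * R k j)"
      by (simp add: sum_distrib_left)
    moreover have "0 \<le> l powr s / (c + l)" using True c by simp
    ultimately show ?thesis using mult_nonneg_nonneg[OF _ R[of y]] by (simp only:)
  next
    case False
    thus ?thesis by (simp add: h_def res_integrand_def)
  qed
  hence "0 \<le> (LINT l|lborel. (\<Sum>j\<in>UNIV. \<Sum>k\<in>UNIV. Re (cnj (z k) * z j * R k j) * h j k l))"
    by (intro integral_nonneg_AE) auto
  also have "\<dots> = (\<Sum>j\<in>UNIV. \<Sum>k\<in>UNIV. Re (cnj (z k) * z j * R k j) * (LINT l|lborel. h j k l))"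
    by (subst Bochner_Integration.integral_sum, (intro Bochner_Integration.integrable_sum integrable_mult_right hint)[1],
        intro sum.cong refl, subst Bochner_Integration.integral_sum) (auto intro!: integrable_mult_right hint)
  also have "\<dots> = C * (\<Sum>j\<in>UNIV. \<Sum>k\<in>UNIV. Re (cnj (z k) * z j * R k j) * loewner_entry s c (w j) (w k))"
    by (simp only: hL sum_distrib_left mult.left_commute)
  finally show ?thesis using C(1) by (simp add: zero_le_mult_iff)
qed

text \<open>Only differences are continuous in s: at s = 0 the pole of w^s / s cancels, since (a^s -
  c^s) / s is the difference quotient at 0 of s -> a^s - c^s.\<close>

lemma pow_prim_diff_tendsto:
  assumes "a > 0" "c > 0"
  shows "((\<lambda>s. pow_prim s a - pow_prim s c) \<longlongrightarrow> pow_prim s0 a - pow_prim s0 c) (at s0)"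
proof (cases "s0 = 0")
  case True
  have "((\<lambda>s. a powr s - c powr s) has_real_derivative ln a - ln c) (at 0)"
    using assms by (auto intro!: derivative_eq_intros)
  hence "((\<lambda>s. (a powr s - c powr s) / s) \<longlongrightarrow> ln a - ln c) (at 0)"
    using assms by (simp add: has_field_derivative_iff)
  moreover have "\<forall>\<^sub>F s in at 0. (a powr s - c powr s) / s = pow_prim s a - pow_prim s c"
    by (auto simp: eventually_at_filter pow_prim_def diff_divide_distrib)
  ultimately show ?thesis unfolding True
    using tendsto_cong by (simp add: pow_prim_def[of 0]) fast
next
  case False
  have "((\<lambda>s. a powr s / s - c powr s / s) \<longlongrightarrow> a powr s0 / s0 - c powr s0 / s0) (at s0)"
    using assms False by (intro tendsto_intros) auto
  moreover have "\<forall>\<^sub>F s in at s0. a powr s / s - c powr s / s = pow_prim s a - pow_prim s c"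
    using eventually_neq_at_within[of 0 s0] by eventually_elim (simp add: pow_prim_def)
  ultimately show ?thesis using False
    using tendsto_cong by (simp add: pow_prim_def[of s0]) fast
qed

lemma loewner_entry_tendsto:
  assumes "a > 0" "b > 0" "c > 0"
  shows "((\<lambda>s. loewner_entry s c a b) \<longlongrightarrow> loewner_entry s0 c a b) (at s0)"
proof -
  have "((\<lambda>s. pow_dd s a b) \<longlongrightarrow> pow_dd s0 a b) (at s0)"
  proof (cases "a = b")
    case True
    show ?thesis unfolding pow_dd_def using True assms by (auto intro!: tendsto_intros)
  next
    case False
    show ?thesis unfolding pow_dd_def using False assms
      by (auto intro!: tendsto_intros pow_prim_diff_tendsto)
  qed
  thus ?thesis
    unfolding loewner_entry_def using assms by (intro tendsto_intros pow_prim_diff_tendsto)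
qed

text \<open>Adds s = -1 and s = 0, that is \<alpha> = 1/2 and \<alpha> = 1, as limits from the right
  through exponents of (-1, 1) different from 0.\<close>

lemma loewner_form_nonneg:
  fixes R :: "'i::finite \<Rightarrow> 'i \<Rightarrow> complex" and w :: "'i \<Rightarrow> real"
  assumes s: "-1 \<le> s" "s < 1"
    and R: "\<And>y. 0 \<le> Re (\<Sum>j\<in>UNIV. \<Sum>k\<in>UNIV. cnj (y k) * y j * R k j)"
    and w: "\<And>j. w j > 0" and c: "c > 0"
  shows "0 \<le> (\<Sum>j\<in>UNIV. \<Sum>k\<in>UNIV. Re (cnj (z k) * z j * R k j) * loewner_entry s c (w j) (w k))"
proof (rule tendsto_lowerbound)
  let ?f = "\<lambda>s. \<Sum>j\<in>UNIV. \<Sum>k\<in>UNIV. Re (cnj (z k) * z j * R k j) * loewner_entry s c (w j) (w k)"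
  have "(?f \<longlongrightarrow> ?f s) (at s)"
    using w c by (intro tendsto_intros loewner_entry_tendsto)
  thus "(?f \<longlongrightarrow> ?f s) (at_right s)"
    by (rule filterlim_mono) (auto simp: at_le)
  have "\<forall>\<^sub>F t in at_right s. t \<noteq> 0"
    by (rule eventually_neq_at_within)
  moreover have "\<forall>\<^sub>F t in at_right s. t \<in> {s<..<1}"
    by (rule eventually_at_rightI[OF _ s(2)]) 
  ultimately show "\<forall>\<^sub>F t in at_right s. 0 \<le> ?f t"
    by eventually_elim (use s in \<open>intro loewner_form_nonneg_nonzero R w c; auto\<close>)
qed auto

section \<open>Optimality\<close>

definition div_slope :: "real \<Rightarrow> real \<Rightarrow> real" where
  "div_slope \<alpha> x = (if \<alpha> = 1 then ln x + 1 else \<alpha> / (\<alpha> - 1) * x powr (\<alpha> - 1))"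

definition div_term :: "real \<Rightarrow> real \<Rightarrow> real \<Rightarrow> real" where
  "div_term \<alpha> p q = p * div_slope \<alpha> (p / q) - q * (p / q) powr \<alpha>"

definition div_lift :: "real \<Rightarrow> real \<Rightarrow> real" where
  "div_lift \<alpha> F = (if \<alpha> = 1 then F else 1 / (\<alpha> - 1) * ln ((\<alpha> - 1) * F))"

lemma div_slope_eq_pow_prim:
  assumes "\<alpha> > 0" "x > 0"
  shows "div_slope \<alpha> x = pow_prim (1 - 1 / \<alpha>) (x powr \<alpha>)"
proof (cases "\<alpha> = 1")
  case False
  have "\<alpha> * (1 - 1 / \<alpha>) = \<alpha> - 1" using assms by (simp add: field_simps)
  thus ?thesis using assms False by (simp add: div_slope_def pow_prim_def powr_powr) (simp add: field_simps)
qed (use assms in \<open>simp add: div_slope_def pow_prim_def\<close>)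

lemma div_term_0: "div_term \<alpha> 0 0 = 0"
  by (simp add: div_term_def)

lemma div_term_eq:
  assumes "\<alpha> \<noteq> 1" "p > 0" "q > 0"
  shows "(\<alpha> - 1) * div_term \<alpha> p q = p powr \<alpha> * q powr (1 - \<alpha>)"
proof -
  have 1: "p * (p / q) powr (\<alpha> - 1) = p powr \<alpha> * q powr (1 - \<alpha>)"
    using assms by (simp add: powr_divide powr_diff)
  have 2: "q * (p / q) powr \<alpha> = p powr \<alpha> * q powr (1 - \<alpha>)"
    using assms by (simp add: powr_divide powr_diff)
  have "(\<alpha> - 1) * div_term \<alpha> p q
      = \<alpha> * (p * (p / q) powr (\<alpha> - 1)) - (\<alpha> - 1) * (q * (p / q) powr \<alpha>)"
    using assms(1) by (simp add: div_term_def div_slope_def field_simps)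
  thus ?thesis unfolding 1 2 by (simp add: algebra_simps)
qed

lemma div_term_1: "p > 0 \<Longrightarrow> q > 0 \<Longrightarrow> div_term 1 p q = p * ln (p / q)"
  by (simp add: div_term_def div_slope_def algebra_simps)

lemma renyi_divergence_eq_lift:
  assumes "\<And>y. y \<in> Y \<Longrightarrow> p y = 0 \<and> q y = 0 \<or> 0 < p y \<and> 0 < q y"
  shows "renyi_divergence \<alpha> Y p q = div_lift \<alpha> (\<Sum>y\<in>Y. div_term \<alpha> (p y) (q y))"
proof (cases "\<alpha> = 1")
  case True
  have "p y * ln (p y / q y) = div_term 1 (p y) (q y)" if "y \<in> Y" for y
    using assms[OF that] by (auto simp: div_term_0 div_term_1)
  thus ?thesis using True by (simp add: renyi_divergence_def div_lift_def)
next
  case False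
  have "p y powr \<alpha> * q y powr (1 - \<alpha>) = (\<alpha> - 1) * div_term \<alpha> (p y) (q y)" if "y \<in> Y" for y
    using assms[OF that] False by (auto simp: div_term_0 div_term_eq)
  thus ?thesis using False by (simp add: renyi_divergence_def div_lift_def sum_distrib_left)
qed

lemma div_sum_pos:
  assumes "\<And>y. y \<in> Y \<Longrightarrow> p y = 0 \<and> q y = 0 \<or> 0 < p y \<and> 0 < q y" "sum p Y = 1" "\<alpha> \<noteq> 1"
  shows "0 < (\<alpha> - 1) * (\<Sum>y\<in>Y. div_term \<alpha> (p y) (q y))"
proof -
  have Y: "finite Y" using assms(2) by (metis sum.infinite zero_neq_one)
  obtain y where y: "y \<in> Y" "p y \<noteq> 0"
    using assms(2) by (metis sum.neutral zero_neq_one)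
  have eq: "(\<alpha> - 1) * div_term \<alpha> (p y) (q y) = p y powr \<alpha> * q y powr (1 - \<alpha>)" if "y \<in> Y" for y
    using assms(1)[OF that] assms(3) by (auto simp: div_term_0 div_term_eq)
  have "0 < p y powr \<alpha> * q y powr (1 - \<alpha>)" using assms(1)[OF y(1)] y(2) by auto
  hence "0 < (\<Sum>y\<in>Y. p y powr \<alpha> * q y powr (1 - \<alpha>))"
    using Y y(1) by (intro sum_pos2[of _ y]) auto
  thus ?thesis by (simp add: sum_distrib_left eq)
qed

text \<open>For \<alpha> < 1 the sums are negative. Multiplication by \<alpha> - 1 reverses the
  order once, the negative prefactor of the logarithm a second time.\<close>

lemma div_lift_mono:
  assumes "F \<le> G" "\<alpha> \<noteq> 1 \<Longrightarrow> 0 < (\<alpha> - 1) * F" "\<alpha> \<noteq> 1 \<Longrightarrow> 0 < (\<alpha> - 1) * G"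
  shows "div_lift \<alpha> F \<le> div_lift \<alpha> G"
proof -
  consider "\<alpha> = 1" | "\<alpha> > 1" | "\<alpha> < 1" by linarith
  thus ?thesis
  proof cases
    case 2
    hence "ln ((\<alpha> - 1) * F) \<le> ln ((\<alpha> - 1) * G)" using assms by (subst ln_le_cancel_iff) auto
    thus ?thesis using 2 by (simp add: div_lift_def divide_right_mono)
  next
    case 3
    hence "ln ((\<alpha> - 1) * G) \<le> ln ((\<alpha> - 1) * F)"
      using assms by (subst ln_le_cancel_iff) (auto simp: mult_left_mono_neg)
    thus ?thesis using 3 by (simp add: div_lift_def divide_right_mono_neg)
  qed (use assms in \<open>simp add: div_lift_def\<close>)
qed

section \<open>The dual certificate of a balanced basis\<close>

definition likelihood_ratio where
  "likelihood_ratio \<rho> \<sigma> b j = outcome_prob \<rho> (ket_bra (b j)) / outcome_prob \<sigma> (ket_bra (b j))"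

text \<open>The second clause is criticality between outcomes of different likelihood ratio; the first one
  says that no pair of equal likelihood ratio offers a two-level direction.\<close>

definition balanced ::
    "real \<Rightarrow> complex^'d^'d \<Rightarrow> complex^'d^'d \<Rightarrow> ('d \<Rightarrow> complex^'d) \<Rightarrow> bool" where
  "balanced \<alpha> \<rho> \<sigma> b \<longleftrightarrow>
     (\<forall>j k. j \<noteq> k \<longrightarrow> (let x = likelihood_ratio \<rho> \<sigma> b j; y = likelihood_ratio \<rho> \<sigma> b k;
        r = cinner (b j) (\<rho> *v b k); s = cinner (b j) (\<sigma> *v b k) in
        if x = y then r = of_real x * s
        else of_real (div_slope \<alpha> x - div_slope \<alpha> y) * r = of_real (x powr \<alpha> - y powr \<alpha>) * s))"

lemma pos_def_outcome_pos:
  assumes "pos_def \<rho>" "orthonormal_basis b"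
  shows "0 < outcome_prob \<rho> (ket_bra (b j))"
proof -
  have "b j \<noteq> 0" using assms(2) unfolding orthonormal_basis_def
    by (metis cinner_zero_right zero_neq_one)
  thus ?thesis using assms(1) by (simp add: outcome_prob_ket_bra pos_def_def)
qed

lemma outcome_prob_zero: "outcome_prob \<rho> 0 = 0"
  by (simp add: outcome_prob_def matrix_matrix_mult_def trace_def)

lemma povm_outcomes:
  assumes "povm m M" "pos_def \<rho>" "pos_def \<sigma>" "y \<in> {..<m}"
  shows "outcome_prob \<rho> (M y) = 0 \<and> outcome_prob \<sigma> (M y) = 0 \<or>
    0 < outcome_prob \<rho> (M y) \<and> 0 < outcome_prob \<sigma> (M y)"
  using assms by (cases "M y = 0") (auto simp: outcome_prob_zero povm_def outcome_prob_pos)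

lemma powr_eq_iff: "x > 0 \<Longrightarrow> y > 0 \<Longrightarrow> a \<noteq> 0 \<Longrightarrow> x powr a = y powr a \<longleftrightarrow> x = y" for x y a :: real
  by (metis powr_inj powr_powr powr_one nonzero_divide_eq_eq times_divide_eq_right mult.commute less_imp_le right_inverse divide_inverse)

lemma cinner_sum_form:
  "cinner (\<Sum>k\<in>UNIV. z k *s b k) (A *v (\<Sum>j\<in>UNIV. z j *s b j))
    = (\<Sum>j\<in>UNIV. \<Sum>k\<in>UNIV. cnj (z k) * z j * cinner (b k) (A *v b j))"
  by (simp add: cinner_sum_left cinner_scale_left mult_vec_sum mult_vec_scale cinner_sum_right
      cinner_scale_right sum_distrib_left mult_ac)

lemma cinner_basis_form:
  assumes "orthonormal_basis b"
  shows "cinner v (A *v v)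
    = (\<Sum>j\<in>UNIV. \<Sum>k\<in>UNIV. cnj (cinner (b k) v) * cinner (b j) v * cinner (b k) (A *v b j))"
  using cinner_sum_form[of "\<lambda>j. cinner (b j) v" b A] by (simp flip: orthonormal_expansion[OF assms])

text \<open>Multiplication by P_j from the right selects, as the j-th column in the basis
  \<open>b\<close>, the operator whose pairing with an outcome is the tangent functional at the
  ratio x_j.\<close>

definition dual_operator where
  "dual_operator \<alpha> \<rho> \<sigma> b = (\<Sum>j\<in>UNIV.
     (div_slope \<alpha> (likelihood_ratio \<rho> \<sigma> b j) *\<^sub>R \<rho> - (likelihood_ratio \<rho> \<sigma> b j powr \<alpha>) *\<^sub>R \<sigma>)
       ** ket_bra (b j))"

lemma dual_operator_feasible:
  fixes \<rho> \<sigma> :: "complex^'d^'d"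
  assumes \<alpha>: "\<alpha> \<ge> 1 / 2" and b: "orthonormal_basis b" and bal: "balanced \<alpha> \<rho> \<sigma> b"
    and \<rho>: "pos_def \<rho>" and \<sigma>: "pos_def \<sigma>" and c: "c > 0"
  shows "0 \<le> Re (cinner v ((dual_operator \<alpha> \<rho> \<sigma> b - (div_slope \<alpha> c *\<^sub>R \<rho> - (c powr \<alpha>) *\<^sub>R \<sigma>)) *v v))"
proof -
  define x where "x = likelihood_ratio \<rho> \<sigma> b"
  define A where "A t = div_slope \<alpha> t *\<^sub>R \<rho> - (t powr \<alpha>) *\<^sub>R \<sigma>" for t
  define z where "z j = cinner (b j) v" for j
  define w where "w j = x j powr \<alpha>" for j
  define s where "s = 1 - 1 / \<alpha>"
  have s: "-1 \<le> s" "s < 1" using \<alpha> by (auto simp: s_def field_simps)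
  have x: "x j > 0" for j
    using pos_def_outcome_pos[OF \<rho> b] pos_def_outcome_pos[OF \<sigma> b]
    by (simp add: x_def likelihood_ratio_def)
  have w: "w j > 0" for j using x[of j] by (simp add: w_def)
  have slope: "div_slope \<alpha> t = pow_prim s (t powr \<alpha>)" if "t > 0" for t
    unfolding s_def using \<alpha> that by (intro div_slope_eq_pow_prim) auto
  have Aform: "cinner u (A t *v u') = of_real (div_slope \<alpha> t) * cinner u (\<rho> *v u')
      - of_real (t powr \<alpha>) * cinner u (\<sigma> *v u')" for t u u'
    by (simp add: A_def matrix_vector_mult_diff_rdistrib cinner_diff_right scaleR_mult_vec
        cinner_scaleR_right)
  have "cinner v (dual_operator \<alpha> \<rho> \<sigma> b *v v) = (\<Sum>j\<in>UNIV. z j * cinner v (A (x j) *v b j))"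
    by (simp add: dual_operator_def A_def x_def z_def mult_vec_sum_left cinner_sum_right
        matrix_vector_mul_assoc[symmetric] ket_bra_mult_vec mult_vec_scale cinner_scale_right)
  also have "\<dots> = (\<Sum>j\<in>UNIV. \<Sum>k\<in>UNIV. cnj (z k) * z j * cinner (b k) (A (x j) *v b j))"
  proof -
    have "cinner v u = (\<Sum>k\<in>UNIV. cnj (z k) * cinner (b k) u)" for u
      by (subst orthonormal_expansion[OF b, of v]) (simp add: cinner_sum_left cinner_scale_left z_def)
    thus ?thesis by (simp add: sum_distrib_left mult_ac)
  qed
  finally have "cinner v ((dual_operator \<alpha> \<rho> \<sigma> b - A c) *v v) = (\<Sum>j\<in>UNIV. \<Sum>k\<in>UNIV.
      cnj (z k) * z j * (cinner (b k) (A (x j) *v b j) - cinner (b k) (A c *v b j)))"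
    by (simp add: matrix_vector_mult_diff_rdistrib cinner_diff_right cinner_basis_form[OF b, of v "A c"]
        z_def sum_subtractf right_diff_distrib)
  also have "\<dots> = (\<Sum>j\<in>UNIV. \<Sum>k\<in>UNIV. cnj (z k) * z j * cinner (b k) (\<rho> *v b j)
      * of_real (loewner_entry s (c powr \<alpha>) (w j) (w k)))"
  proof (intro sum.cong refl)
    fix j k
    let ?r = "cinner (b k) (\<rho> *v b j)" and ?s = "cinner (b k) (\<sigma> *v b j)"
    \<comment> \<open>This relation also covers equal indices, where it says p_j = x_j q_j. It
      eliminates \<sigma>, so that \<rho> alone carries the positivity.\<close>
    have rs: "?s = of_real (pow_dd s (w j) (w k)) * ?r"
    proof (cases "x j = x k")
      case True
      have "?r = of_real (x j) * ?s"
      proof (cases "j = k")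
        case jk: True
        have "outcome_prob \<rho> (ket_bra (b k)) = x k * outcome_prob \<sigma> (ket_bra (b k))"
          using pos_def_outcome_pos[OF \<sigma> b, of k] by (simp add: x_def likelihood_ratio_def)
        thus ?thesis using \<rho> \<sigma> jk
          by (simp add: complex_eq_iff outcome_prob_ket_bra pos_def_def pos_semidef_form_real)
      next
        case False
        thus ?thesis using bal True unfolding balanced_def Let_def x_def by metis
      qed
      \<comment> \<open>At equal arguments the divided difference is w^(s - 1) = x^(\<alpha> (s -
        1)), and \<alpha> (s - 1) = -1.\<close>
      moreover have "pow_dd s (w j) (w k) = 1 / x j"
      proof -
        have "\<alpha> * (s - 1) = - 1" using \<alpha> by (simp add: s_def)
        thus ?thesis using x[of j] True
          by (simp add: pow_dd_def w_def powr_powr powr_minus_divide)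
      qed
      ultimately show ?thesis using x[of j] by simp
    next
      case False
      hence wjk: "w j \<noteq> w k" using x[of j] x[of k] \<alpha> by (simp add: w_def powr_eq_iff)
      have "of_real (div_slope \<alpha> (x k) - div_slope \<alpha> (x j)) * ?r = of_real (w k - w j) * ?s"
        using bal False unfolding balanced_def Let_def x_def w_def by metis
      hence "of_real (w k - w j) * ?s = of_real (pow_prim s (w k) - pow_prim s (w j)) * ?r"
        using slope x by (simp add: w_def)
      moreover have "pow_prim s (w k) - pow_prim s (w j) = (w k - w j) * pow_dd s (w j) (w k)"
        using wjk by (simp add: pow_dd_def field_simps)
      ultimately have "of_real (w k - w j) * ?s = of_real (w k - w j) * (of_real (pow_dd s (w j) (w k)) * ?r)"
        by (simp only: of_real_mult mult.assoc)
      thus ?thesis using wjk by (simp only: mult_cancel_left of_real_eq_0_iff) simp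
    qed
    have "cinner (b k) (A (x j) *v b j) - cinner (b k) (A c *v b j)
        = ?r * of_real (loewner_entry s (c powr \<alpha>) (w j) (w k))"
      unfolding Aform rs using x c
      by (simp add: slope loewner_entry_def w_def algebra_simps)
    thus "cnj (z k) * z j * (cinner (b k) (A (x j) *v b j) - cinner (b k) (A c *v b j))
        = cnj (z k) * z j * ?r * of_real (loewner_entry s (c powr \<alpha>) (w j) (w k))"
      by (simp only: mult.assoc)
  qed
  finally have eq: "Re (cinner v ((dual_operator \<alpha> \<rho> \<sigma> b - A c) *v v)) = (\<Sum>j\<in>UNIV. \<Sum>k\<in>UNIV.
      Re (cnj (z k) * z j * cinner (b k) (\<rho> *v b j)) * loewner_entry s (c powr \<alpha>) (w j) (w k))"
    by simp
  have "0 \<le> Re (\<Sum>j\<in>UNIV. \<Sum>k\<in>UNIV. cnj (y k) * y j * cinner (b k) (\<rho> *v b j))" for y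
  proof -
    let ?u = "\<Sum>j\<in>UNIV. y j *s b j"
    have "0 \<le> Re (cinner ?u (\<rho> *v ?u))"
      using \<rho> by (cases "?u = 0") (auto simp: pos_def_def less_imp_le)
    thus ?thesis by (simp only: cinner_sum_form)
  qed
  from loewner_form_nonneg[OF s this w, of "c powr \<alpha>" z] c
  show ?thesis unfolding eq[unfolded A_def] by simp
qed

lemma balanced_bound:
  fixes \<rho> \<sigma> :: "complex^'d^'d"
  assumes \<alpha>: "\<alpha> \<ge> 1 / 2" and b: "orthonormal_basis b" and bal: "balanced \<alpha> \<rho> \<sigma> b"
    and \<rho>: "pos_def \<rho>" and \<sigma>: "pos_def \<sigma>" and M: "povm m M"
  shows "(\<Sum>y<m. div_term \<alpha> (outcome_prob \<rho> (M y)) (outcome_prob \<sigma> (M y)))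
    \<le> (\<Sum>j\<in>UNIV. div_term \<alpha> (outcome_prob \<rho> (ket_bra (b j))) (outcome_prob \<sigma> (ket_bra (b j))))"
proof -
  let ?\<Lambda> = "dual_operator \<alpha> \<rho> \<sigma> b"
  have "(\<Sum>y<m. div_term \<alpha> (outcome_prob \<rho> (M y)) (outcome_prob \<sigma> (M y)))
      \<le> (\<Sum>y<m. outcome_prob ?\<Lambda> (M y))"
  proof (intro sum_mono)
    fix y assume y: "y \<in> {..<m}"
    let ?p = "outcome_prob \<rho> (M y)" and ?q = "outcome_prob \<sigma> (M y)"
    show "div_term \<alpha> ?p ?q \<le> outcome_prob ?\<Lambda> (M y)"
    proof (cases "M y = 0")
      case True
      thus ?thesis by (simp add: outcome_prob_zero div_term_0)
    next
      case False
      have psd: "pos_semidef (M y)" using M y by (simp add: povm_def)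
      have "?p > 0" "?q > 0" using outcome_prob_pos[OF psd False] \<rho> \<sigma> by auto
      \<comment> \<open>The parameter is taken to be the outcome's own ratio, at which p U(c) - q
        c^\<alpha> is \<open>div_term\<close> itself.\<close>
      hence "0 \<le> outcome_prob (?\<Lambda> - (div_slope \<alpha> (?p / ?q) *\<^sub>R \<rho> - ((?p / ?q) powr \<alpha>) *\<^sub>R \<sigma>)) (M y)"
        by (intro outcome_prob_nonneg psd dual_operator_feasible assms) auto
      thus ?thesis
        by (simp add: outcome_prob_diff_left outcome_prob_scaleR_left div_term_def mult.commute)
    qed
  qed
  \<comment> \<open>No slack remains for the PVM: the trace of the j-th summand is p_j U(x_j) - q_j
    x_j^\<alpha>, its own \<open>div_term\<close>.\<close>
  also have "\<dots> = outcome_prob ?\<Lambda> (mat 1)"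
    using M by (simp add: outcome_prob_sum[symmetric] povm_def)
  also have "\<dots> = (\<Sum>j\<in>UNIV. div_term \<alpha> (outcome_prob \<rho> (ket_bra (b j))) (outcome_prob \<sigma> (ket_bra (b j))))"
  proof -
    have "outcome_prob (A ** B) (mat 1) = outcome_prob A B" for A B :: "complex^'d^'d"
      by (simp add: outcome_prob_def)
    thus ?thesis
      by (simp add: dual_operator_def outcome_prob_sum_left outcome_prob_diff_left
          outcome_prob_scaleR_left div_term_def likelihood_ratio_def mult.commute)
  qed
  finally show ?thesis .
qed

lemma pvm_of_basis_nth: "pvm_of_basis b $ j = ket_bra (b j)"
  by (simp add: pvm_of_basis_def)

lemma outcome_prob_basis_sum:
  assumes "orthonormal_basis b" "trace \<rho> = 1"
  shows "(\<Sum>j\<in>UNIV. outcome_prob \<rho> (ket_bra (b j))) = 1"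
  using assms by (simp add: outcome_prob_sum[symmetric] orthonormal_basis_matrix outcome_prob_mat_1)

lemma faithful_simps:
  assumes "faithful_density_operator \<rho>"
  shows "pos_def \<rho>" "trace \<rho> = 1"
  using assms by (auto simp: faithful_density_operator_def density_operator_def)

lemma pvm_divergence_eq_lift:
  assumes "orthonormal_basis b" "pos_def \<rho>" "pos_def \<sigma>"
  shows "pvm_divergence \<alpha> \<rho> \<sigma> (pvm_of_basis b) = div_lift \<alpha>
    (\<Sum>j\<in>UNIV. div_term \<alpha> (outcome_prob \<rho> (ket_bra (b j))) (outcome_prob \<sigma> (ket_bra (b j))))"
  unfolding pvm_divergence_def pvm_of_basis_nth
  using pos_def_outcome_pos[OF _ assms(1)] assms by (intro renyi_divergence_eq_lift) auto

lemma balanced_povm_le_half: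
  fixes \<rho> \<sigma> :: "complex^'d^'d"
  assumes \<alpha>: "\<alpha> \<ge> 1 / 2" and b: "orthonormal_basis b" and bal: "balanced \<alpha> \<rho> \<sigma> b"
    and \<rho>: "faithful_density_operator \<rho>" and \<sigma>: "faithful_density_operator \<sigma>" and M: "povm m M"
  shows "povm_divergence \<alpha> \<rho> \<sigma> m M \<le> pvm_divergence \<alpha> \<rho> \<sigma> (pvm_of_basis b)"
proof -
  note f = faithful_simps[OF \<rho>] faithful_simps[OF \<sigma>]
  note out = povm_outcomes[OF M f(1,3)]
  have "povm_divergence \<alpha> \<rho> \<sigma> m M
      = div_lift \<alpha> (\<Sum>y<m. div_term \<alpha> (outcome_prob \<rho> (M y)) (outcome_prob \<sigma> (M y)))"
    unfolding povm_divergence_def using out by (intro renyi_divergence_eq_lift) auto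
  also have "\<dots> \<le> div_lift \<alpha>
    (\<Sum>j\<in>UNIV. div_term \<alpha> (outcome_prob \<rho> (ket_bra (b j))) (outcome_prob \<sigma> (ket_bra (b j))))"
  proof (intro div_lift_mono balanced_bound \<alpha> b bal f M div_sum_pos)
    have "(\<Sum>y<m. M y) = mat 1" using M by (simp add: povm_def)
    thus "(\<Sum>y<m. outcome_prob \<rho> (M y)) = 1"
      using f(2) by (simp flip: outcome_prob_sum add: outcome_prob_mat_1)
  qed (use out pos_def_outcome_pos[OF _ b] f outcome_prob_basis_sum[OF b] in auto)
  finally show ?thesis by (simp add: pvm_divergence_eq_lift[OF b f(1,3)])
qed

text \<open>Both sides contain the same power sum, and the prefactors agree because the order 1 -
  \<alpha> has prefactor -1/\<alpha>. The factor \<alpha> / (1 - \<alpha>) is positive, so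
  comparisons of divergences carry over.\<close>

lemma renyi_divergence_swap:
  assumes "0 < \<alpha>" "\<alpha> < 1"
  shows "renyi_divergence \<alpha> Y p q = \<alpha> / (1 - \<alpha>) * renyi_divergence (1 - \<alpha>) Y q p"
  using assms by (simp add: renyi_divergence_def mult.commute field_simps)

text \<open>The ratios become reciprocals, so slopes and powers trade places up to the factor
  (\<alpha> - 1) / \<alpha>. The new condition for unequal ratios is the old one multiplied by this
  factor.\<close>

lemma balanced_swap:
  assumes \<alpha>: "0 < \<alpha>" "\<alpha> < 1" and bal: "balanced \<alpha> \<rho> \<sigma> b"
    and b: "orthonormal_basis b" and \<rho>: "pos_def \<rho>" and \<sigma>: "pos_def \<sigma>"
  shows "balanced (1 - \<alpha>) \<sigma> \<rho> b"
  unfolding balanced_def Let_def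
proof (intro allI impI)
  fix j k :: 'a assume jk: "j \<noteq> k"
  define x where "x = likelihood_ratio \<rho> \<sigma> b j"
  define y where "y = likelihood_ratio \<rho> \<sigma> b k"
  define r where "r = cinner (b j) (\<rho> *v b k)"
  define s where "s = cinner (b j) (\<sigma> *v b k)"
  have inv: "likelihood_ratio \<sigma> \<rho> b i = 1 / likelihood_ratio \<rho> \<sigma> b i" for i
    by (simp add: likelihood_ratio_def)
  have xy: "x > 0" "y > 0"
    using pos_def_outcome_pos[OF _ b] \<rho> \<sigma> by (simp_all add: x_def y_def likelihood_ratio_def)
  have B: "if x = y then r = of_real x * s
      else of_real (div_slope \<alpha> x - div_slope \<alpha> y) * r = of_real (x powr \<alpha> - y powr \<alpha>) * s"
    using bal jk unfolding balanced_def Let_def x_def y_def r_def s_def by blast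
  have "if 1 / x = 1 / y then s = of_real (1 / x) * r
      else of_real (div_slope (1 - \<alpha>) (1 / x) - div_slope (1 - \<alpha>) (1 / y)) * s
        = of_real ((1 / x) powr (1 - \<alpha>) - (1 / y) powr (1 - \<alpha>)) * r"
  proof (cases "x = y")
    case True
    thus ?thesis using B xy by simp
  next
    case False
    have pw: "(1 / t) powr (1 - \<alpha>) = t powr (\<alpha> - 1)" if "t > 0" for t
      using that by (simp add: powr_divide powr_diff)
    have sl: "div_slope (1 - \<alpha>) (1 / t) = (\<alpha> - 1) / \<alpha> * t powr \<alpha>" if "t > 0" for t
      using that \<alpha> by (simp add: div_slope_def powr_divide powr_minus_divide field_simps)
    have "of_real (\<alpha> / (\<alpha> - 1) * (x powr (\<alpha> - 1) - y powr (\<alpha> - 1))) * r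
        = of_real (x powr \<alpha> - y powr \<alpha>) * s"
      using B False \<alpha> by (simp add: div_slope_def right_diff_distrib)
    hence "of_real ((\<alpha> - 1) / \<alpha>) * (of_real (\<alpha> / (\<alpha> - 1) * (x powr (\<alpha> - 1) - y powr (\<alpha> - 1))) * r)
        = of_real ((\<alpha> - 1) / \<alpha>) * (of_real (x powr \<alpha> - y powr \<alpha>) * s)" by (rule arg_cong)
    hence "of_real (x powr (\<alpha> - 1) - y powr (\<alpha> - 1)) * r
        = of_real ((\<alpha> - 1) / \<alpha> * (x powr \<alpha> - y powr \<alpha>)) * s"
      using \<alpha> by (simp only: mult.assoc[symmetric] of_real_mult[symmetric]) simp
    thus ?thesis using False xy by (simp add: pw sl right_diff_distrib)
  qed
  thus "if likelihood_ratio \<sigma> \<rho> b j = likelihood_ratio \<sigma> \<rho> b k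
      then cinner (b j) (\<sigma> *v b k) = of_real (likelihood_ratio \<sigma> \<rho> b j) * cinner (b j) (\<rho> *v b k)
      else of_real (div_slope (1 - \<alpha>) (likelihood_ratio \<sigma> \<rho> b j)
          - div_slope (1 - \<alpha>) (likelihood_ratio \<sigma> \<rho> b k)) * cinner (b j) (\<sigma> *v b k)
        = of_real (likelihood_ratio \<sigma> \<rho> b j powr (1 - \<alpha>) - likelihood_ratio \<sigma> \<rho> b k powr (1 - \<alpha>))
          * cinner (b j) (\<rho> *v b k)"
    unfolding inv x_def[symmetric] y_def[symmetric] r_def[symmetric] s_def[symmetric] .
qed

lemma balanced_povm_le:
  fixes \<rho> \<sigma> :: "complex^'d^'d"
  assumes \<alpha>: "\<alpha> > 0" and b: "orthonormal_basis b" and bal: "balanced \<alpha> \<rho> \<sigma> b"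
    and \<rho>: "faithful_density_operator \<rho>" and \<sigma>: "faithful_density_operator \<sigma>" and M: "povm m M"
  shows "povm_divergence \<alpha> \<rho> \<sigma> m M \<le> pvm_divergence \<alpha> \<rho> \<sigma> (pvm_of_basis b)"
proof (cases "\<alpha> \<ge> 1 / 2")
  case False
  hence \<alpha>': "0 < \<alpha>" "\<alpha> < 1" "1 - \<alpha> \<ge> 1 / 2" using \<alpha> by auto
  have "balanced (1 - \<alpha>) \<sigma> \<rho> b"
    using faithful_simps \<rho> \<sigma> by (intro balanced_swap \<alpha>' bal b) auto
  from balanced_povm_le_half[OF \<alpha>'(3) b this \<sigma> \<rho> M] \<alpha>'
  show ?thesis
    unfolding povm_divergence_def pvm_divergence_def
    by (subst (1 2) renyi_divergence_swap) (auto intro!: divide_right_mono mult_left_mono)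
qed (use assms in \<open>intro balanced_povm_le_half\<close>)

section \<open>Comparison with the supremum over POVMs\<close>

lemma pvm_as_povm:
  fixes b :: "'d \<Rightarrow> complex^'d"
  assumes "orthonormal_basis b"
  obtains m M where "povm m M" "povm_divergence \<alpha> \<rho> \<sigma> m M = pvm_divergence \<alpha> \<rho> \<sigma> (pvm_of_basis b)"
proof -
  obtain e where e: "bij_betw e {..<CARD('d)} (UNIV :: 'd set)"
    using ex_bij_betw_nat_finite[of "UNIV :: 'd set"] by (auto simp: atLeast0LessThan)
  define M where "M y = ket_bra (b (e y))" for y
  have re: "(\<Sum>y<CARD('d). f (e y)) = (\<Sum>j\<in>UNIV. f j)" for f :: "'d \<Rightarrow> 'x::comm_monoid_add"
    by (rule sum.reindex_bij_betw[OF e])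
  have "(\<Sum>y<CARD('d). M y) = mat 1"
    unfolding M_def re[of "\<lambda>j. ket_bra (b j)"] by (rule orthonormal_basis_matrix[OF assms])
  hence "povm (CARD('d)) M"
    by (simp add: povm_def M_def pos_semidef_ket_bra)
  moreover have "povm_divergence \<alpha> \<rho> \<sigma> (CARD('d)) M = pvm_divergence \<alpha> \<rho> \<sigma> (pvm_of_basis b)"
    unfolding povm_divergence_def pvm_divergence_def renyi_divergence_def pvm_of_basis_nth M_def
      re[of "\<lambda>j. outcome_prob \<rho> (ket_bra (b j)) * ln (outcome_prob \<rho> (ket_bra (b j)) / outcome_prob \<sigma> (ket_bra (b j)))"]
      re[of "\<lambda>j. outcome_prob \<rho> (ket_bra (b j)) powr \<alpha> * outcome_prob \<sigma> (ket_bra (b j)) powr (1 - \<alpha>)"] ..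
  ultimately show ?thesis using that by blast
qed

lemma balanced_optimal:
  fixes \<rho> \<sigma> :: "complex^'d^'d"
  assumes \<alpha>: "\<alpha> > 0" and b: "orthonormal_basis b" and bal: "balanced \<alpha> \<rho> \<sigma> b"
    and \<rho>: "faithful_density_operator \<rho>" and \<sigma>: "faithful_density_operator \<sigma>"
  shows "globally_optimal \<alpha> \<rho> \<sigma> (pvm_of_basis b)"
  unfolding globally_optimal_def measured_divergence_def
proof (rule antisym)
  obtain m M where "povm m M" "povm_divergence \<alpha> \<rho> \<sigma> m M = pvm_divergence \<alpha> \<rho> \<sigma> (pvm_of_basis b)"
    using pvm_as_povm[OF b] by blast
  thus "ereal (pvm_divergence \<alpha> \<rho> \<sigma> (pvm_of_basis b))
      \<le> Sup {ereal (povm_divergence \<alpha> \<rho> \<sigma> m M) | m M. povm m M}"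
    by (intro Sup_upper CollectI exI[of _ m] exI[of _ M]) simp
  show "Sup {ereal (povm_divergence \<alpha> \<rho> \<sigma> m M) | m M. povm m M}
      \<le> ereal (pvm_divergence \<alpha> \<rho> \<sigma> (pvm_of_basis b))"
    using balanced_povm_le[OF \<alpha> b bal \<rho> \<sigma>] by (intro Sup_least) auto
qed

section \<open>Two-level rotations\<close>

lemma cinner_scaleR_left: "cinner (r *\<^sub>R u) v = of_real r * cinner u v"
  by (simp add: cinner_def sum_distrib_left scaleR_conv_of_real[where 'a=complex] mult_ac)

lemma mult_vec_scaleR: "A *v (r *\<^sub>R v) = r *\<^sub>R (A *v v)" for A :: "complex^'d^'d"
  by (simp add: vec_eq_iff matrix_vector_mult_def scaleR_sum_right)

lemma two_level_rotation_apply: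
  assumes "j \<noteq> k"
  shows "two_level_rotation b j k \<phi> \<theta> i =
    (if i = j then cos \<theta> *\<^sub>R b j + sin \<theta> *\<^sub>R (cis \<phi> *s b k)
     else if i = k then cos \<theta> *\<^sub>R b k - sin \<theta> *\<^sub>R (cis (- \<phi>) *s b j) else b i)"
  using assms
  by (auto simp: two_level_rotation_def vec_eq_iff scaleR_conv_of_real[where 'a=complex])

lemma two_level_rotation_0: "j \<noteq> k \<Longrightarrow> two_level_rotation b j k \<phi> 0 = b"
  by (auto simp: two_level_rotation_apply)

lemma two_level_rotation_orthonormal:
  assumes b: "orthonormal_basis b" and jk: "j \<noteq> k"
  shows "orthonormal_basis (two_level_rotation b j k \<phi> \<theta>)"
proof -
  have E: "cis (- \<phi>) * cis \<phi> = 1" "cis \<phi> * cis (- \<phi>) = 1" by (simp_all add: cis_mult)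
  hence E': "cis \<phi> * (cis (- \<phi>) * z) = z" for z by (simp flip: mult.assoc)
  have cs: "complex_of_real (cos \<theta>) * of_real (cos \<theta>) + of_real (sin \<theta>) * of_real (sin \<theta>) = 1"
    by (metis of_real_1 of_real_add of_real_mult power2_eq_square sin_cos_squared_add2)
  have on: "cinner (b i) (b i') = (if i = i' then 1 else 0)" for i i'
    using b by (simp add: orthonormal_basis_def)
  show ?thesis
    unfolding orthonormal_basis_def two_level_rotation_apply[OF jk]
  proof (intro allI)
    fix i i'
    show "cinner (if i = j then cos \<theta> *\<^sub>R b j + sin \<theta> *\<^sub>R (cis \<phi> *s b k)
       else if i = k then cos \<theta> *\<^sub>R b k - sin \<theta> *\<^sub>R (cis (- \<phi>) *s b j) else b i)
       (if i' = j then cos \<theta> *\<^sub>R b j + sin \<theta> *\<^sub>R (cis \<phi> *s b k)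
       else if i' = k then cos \<theta> *\<^sub>R b k - sin \<theta> *\<^sub>R (cis (- \<phi>) *s b j) else b i')
      = (if i = i' then 1 else 0)"
      using jk cs
      by (auto simp: E E' cinner_add_left cinner_add_right cinner_diff_left cinner_diff_right
          cinner_scaleR_left cinner_scaleR_right cinner_scale_left cinner_scale_right on cis_cnj
          algebra_simps)
  qed
qed

lemma outcome_prob_rotation:
  assumes H: "hermitian \<rho>" and jk: "j \<noteq> k"
  shows "outcome_prob \<rho> (ket_bra (two_level_rotation b j k \<phi> \<theta> i)) =
    (if i = j then (cos \<theta>)\<^sup>2 * outcome_prob \<rho> (ket_bra (b j)) + (sin \<theta>)\<^sup>2 * outcome_prob \<rho> (ket_bra (b k))
        + 2 * sin \<theta> * cos \<theta> * Re (cis \<phi> * cinner (b j) (\<rho> *v b k))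
     else if i = k then (cos \<theta>)\<^sup>2 * outcome_prob \<rho> (ket_bra (b k)) + (sin \<theta>)\<^sup>2 * outcome_prob \<rho> (ket_bra (b j))
        - 2 * sin \<theta> * cos \<theta> * Re (cis \<phi> * cinner (b j) (\<rho> *v b k))
     else outcome_prob \<rho> (ket_bra (b i)))"
proof -
  let ?r = "cinner (b j) (\<rho> *v b k)"
  have r: "cinner (b k) (\<rho> *v b j) = cnj ?r" using hermitian_cinner[OF H] by metis
  have E: "cis (- \<phi>) * cis \<phi> = 1" "cis \<phi> * cis (- \<phi>) = 1" by (simp_all add: cis_mult)
  have lin: "\<rho> *v (x *\<^sub>R u + y *\<^sub>R (c *s v)) = x *\<^sub>R (\<rho> *v u) + y *\<^sub>R (c *s (\<rho> *v v))"
    "\<rho> *v (x *\<^sub>R u - y *\<^sub>R (c *s v)) = x *\<^sub>R (\<rho> *v u) - y *\<^sub>R (c *s (\<rho> *v v))" for x y u v c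
    by (simp_all add: matrix_vector_right_distrib matrix_vector_mult_diff_distrib
        mult_vec_scaleR mult_vec_scale)
  have 1: "cinner (x *\<^sub>R b j + y *\<^sub>R (cis \<phi> *s b k)) (\<rho> *v (x *\<^sub>R b j + y *\<^sub>R (cis \<phi> *s b k)))
     = of_real (x * x) * cinner (b j) (\<rho> *v b j) + of_real (y * y) * cinner (b k) (\<rho> *v b k)
       + of_real (x * y) * (cis \<phi> * ?r + cnj (cis \<phi> * ?r))" for x y
    unfolding lin
    by (simp add: cinner_add_left cinner_add_right cinner_scaleR_left cinner_scaleR_right
        cinner_scale_left cinner_scale_right r cis_cnj algebra_simps)
       (simp add: mult.assoc[symmetric] E)
  have 2: "cinner (x *\<^sub>R b k - y *\<^sub>R (cis (- \<phi>) *s b j)) (\<rho> *v (x *\<^sub>R b k - y *\<^sub>R (cis (- \<phi>) *s b j)))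
     = of_real (x * x) * cinner (b k) (\<rho> *v b k) + of_real (y * y) * cinner (b j) (\<rho> *v b j)
       - of_real (x * y) * (cis \<phi> * ?r + cnj (cis \<phi> * ?r))" for x y
    unfolding lin
    by (simp add: cinner_diff_left cinner_diff_right cinner_scaleR_left cinner_scaleR_right
        cinner_scale_left cinner_scale_right r cis_cnj algebra_simps)
       (simp add: mult.assoc[symmetric] E)
  have re: "Re (of_real x * z) = x * Re z" for x z by simp
  show ?thesis
    using jk unfolding two_level_rotation_apply[OF jk] outcome_prob_ket_bra
    by (cases "i = j"; cases "i = k")
       (simp_all only: 1[unfolded complex_add_cnj] 2[unfolded complex_add_cnj] re Re_complex_of_real plus_complex.sel minus_complex.sel if_True if_False simp_thms
        power2_eq_square mult_ac)
qed

section \<open>Derivatives of moving bases and of their PVMs\<close>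

lemma has_vector_derivative_vecI:
  assumes "\<And>i. ((\<lambda>t. f t $ i) has_vector_derivative D $ i) (at x)"
  shows "(f has_vector_derivative D) (at x)"
  unfolding has_vector_derivative_def has_derivative_def
proof (intro conjI vec_tendstoI)
  fix i
  show "((\<lambda>y. ((f y - f (Lim (at x) (\<lambda>x. x)) - (y - Lim (at x) (\<lambda>x. x)) *\<^sub>R D) /\<^sub>R
          norm (y - Lim (at x) (\<lambda>x. x))) $ i) \<longlongrightarrow> 0 $ i) (at x)"
    using assms[of i] unfolding has_vector_derivative_def has_derivative_def by simp
qed (rule bounded_linear_scaleR_left)

definition ket_bra2 :: "complex^'d \<Rightarrow> complex^'d \<Rightarrow> complex^'d^'d" where
  "ket_bra2 u v = (\<chi> r c. u $ r * cnj (v $ c))"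

lemma ket_bra2_same: "ket_bra2 v v = ket_bra v"
  by (simp add: ket_bra2_def ket_bra_def)

lemma has_vector_derivative_ket_bra2:
  assumes "(u has_vector_derivative u') (at x)" "(v has_vector_derivative v') (at x)"
  shows "((\<lambda>t. ket_bra2 (u t) (v t)) has_vector_derivative
    (ket_bra2 (u x) v' + ket_bra2 u' (v x))) (at x)"
proof (intro has_vector_derivative_vecI)
  fix r c
  have nth: "((\<lambda>t. f t $ i) has_vector_derivative f' $ i) (at x)"
    if "(f has_vector_derivative f') (at x)" for f :: "real \<Rightarrow> complex^'a" and f' i
    by (rule bounded_linear.has_vector_derivative[OF bounded_linear_vec_nth that])
  have "((\<lambda>t. u t $ r * cnj (v t $ c)) has_vector_derivative
     (u x $ r * cnj (v' $ c) + u' $ r * cnj (v x $ c))) (at x)"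
    by (intro has_vector_derivative_mult has_vector_derivative_cnj nth assms)
  thus "((\<lambda>t. ket_bra2 (u t) (v t) $ r $ c) has_vector_derivative
     (ket_bra2 (u x) v' + ket_bra2 u' (v x)) $ r $ c) (at x)"
    by (simp add: ket_bra2_def)
qed

text \<open>The basis may move and the angle may run at speed \<open>c\<close>, so that one formula
  serves both a single rotation and the inductive composition of many.\<close>

lemma has_vector_derivative_rotation:
  assumes jk: "j \<noteq> k" and B: "\<And>i. ((\<lambda>t. B t i) has_vector_derivative B' i) (at x)"
  shows "((\<lambda>t. two_level_rotation (B t) j k \<phi> (c * t) i) has_vector_derivative
    (if i = j then cos (c * x) *\<^sub>R B' j - (c * sin (c * x)) *\<^sub>R B x j
        + (sin (c * x) *\<^sub>R (cis \<phi> *s B' k) + (c * cos (c * x)) *\<^sub>R (cis \<phi> *s B x k))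
     else if i = k then cos (c * x) *\<^sub>R B' k - (c * sin (c * x)) *\<^sub>R B x k
        - (sin (c * x) *\<^sub>R (cis (- \<phi>) *s B' j) + (c * cos (c * x)) *\<^sub>R (cis (- \<phi>) *s B x j))
     else B' i)) (at x)"
proof -
  have sc: "((\<lambda>t. z *s B t i) has_vector_derivative z *s B' i) (at x)" for z i
  proof (intro has_vector_derivative_vecI)
    fix r
    have "((\<lambda>t. B t i $ r) has_vector_derivative B' i $ r) (at x)"
      by (rule bounded_linear.has_vector_derivative[OF bounded_linear_vec_nth B])
    from has_vector_derivative_mult_right[OF this, of z]
    show "((\<lambda>t. (z *s B t i) $ r) has_vector_derivative (z *s B' i) $ r) (at x)" by simp
  qed
  have C: "((\<lambda>t. cos (c * t)) has_real_derivative - (c * sin (c * x))) (at x)"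
    and S: "((\<lambda>t. sin (c * t)) has_real_derivative c * cos (c * x)) (at x)"
    by (auto intro!: derivative_eq_intros)
  show ?thesis
    unfolding two_level_rotation_apply[OF jk]
    using jk B has_vector_derivative_add[OF has_vector_derivative_scaleR[OF C B[of j]]
        has_vector_derivative_scaleR[OF S sc[of "cis \<phi>" k]]]
      has_vector_derivative_diff[OF has_vector_derivative_scaleR[OF C B[of k]]
        has_vector_derivative_scaleR[OF S sc[of "cis (- \<phi>)" j]]]
    by auto
qed

lemma has_vector_derivative_pvm_of_basis:
  assumes "\<And>i. ((\<lambda>t. B t i) has_vector_derivative B' i) (at x)"
  shows "((\<lambda>t. pvm_of_basis (B t)) has_vector_derivative
    (\<chi> i. ket_bra2 (B x i) (B' i) + ket_bra2 (B' i) (B x i))) (at x)"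
proof (rule has_vector_derivative_vecI)
  fix i
  show "((\<lambda>t. pvm_of_basis (B t) $ i) has_vector_derivative
    (\<chi> i. ket_bra2 (B x i) (B' i) + ket_bra2 (B' i) (B x i)) $ i) (at x)"
    using has_vector_derivative_ket_bra2[OF assms[of i] assms[of i]]
    by (simp add: pvm_of_basis_nth ket_bra2_same)
qed

section \<open>Derivatives of the divergence\<close>

definition div_lift' :: "real \<Rightarrow> real \<Rightarrow> real" where
  "div_lift' \<alpha> F = (if \<alpha> = 1 then 1 else 1 / ((\<alpha> - 1) * F))"

lemma has_real_derivative_div_slope:
  "x > 0 \<Longrightarrow> (div_slope \<alpha> has_real_derivative \<alpha> * x powr (\<alpha> - 2)) (at x)"
proof (cases "\<alpha> = 1")
  case True
  assume "x > 0"
  hence "((\<lambda>x. ln x + 1) has_real_derivative 1 / x) (at x)"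
    by (auto intro!: derivative_eq_intros)
  thus ?thesis using True \<open>x > 0\<close>
    by (simp add: div_slope_def[abs_def] powr_minus_divide)
next
  case False
  assume "x > 0"
  hence "((\<lambda>x. \<alpha> / (\<alpha> - 1) * x powr (\<alpha> - 1)) has_real_derivative
      \<alpha> / (\<alpha> - 1) * ((\<alpha> - 1) * x powr (\<alpha> - 1 - 1))) (at x)"
    by (intro DERIV_cmult has_real_derivative_powr)
  thus ?thesis using False by (simp add: div_slope_def[abs_def])
qed

text \<open>The contributions from differentiating the slope and the power cancel because p = r q
  for the ratio r; only the derivatives of p and q survive, with the tangent functional as
  coefficients.\<close>

lemma has_real_derivative_div_term:
  fixes p q :: "real \<Rightarrow> real"
  assumes p: "(p has_real_derivative p') (at x)" and q: "(q has_real_derivative q') (at x)"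
    and pos: "p x > 0" "q x > 0"
  shows "((\<lambda>t. div_term \<alpha> (p t) (q t)) has_real_derivative
    p' * div_slope \<alpha> (p x / q x) - q' * (p x / q x) powr \<alpha>) (at x)"
proof -
  define r where "r = p x / q x"
  define r' where "r' = (p' * q x - p x * q') / (q x * q x)"
  have r: "r > 0" using pos by (simp add: r_def)
  have R: "((\<lambda>t. p t / q t) has_real_derivative r') (at x)"
    unfolding r'_def by (rule DERIV_divide[OF p q]) (use pos in auto)
  have S: "((\<lambda>t. div_slope \<alpha> (p t / q t)) has_real_derivative \<alpha> * r powr (\<alpha> - 2) * r') (at x)"
    by (rule DERIV_chain2[where f = "div_slope \<alpha>", OF _ R])
      (use has_real_derivative_div_slope[OF r] in \<open>simp add: r_def\<close>)
  have W: "((\<lambda>t. (p t / q t) powr \<alpha>) has_real_derivative \<alpha> * r powr (\<alpha> - 1) * r') (at x)"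
    by (rule DERIV_chain2[where f = "\<lambda>y. y powr \<alpha>", OF _ R])
      (use has_real_derivative_powr[OF r] in \<open>simp add: r_def\<close>)
  have "r powr (\<alpha> - 1) = r * r powr (\<alpha> - 2)"
    using r powr_add[of r 1 "\<alpha> - 2"] by simp
  moreover have "p x = q x * r" using pos by (simp add: r_def)
  ultimately have "\<alpha> * r powr (\<alpha> - 2) * r' * p x = \<alpha> * r powr (\<alpha> - 1) * r' * q x" by simp
  hence "(p' * div_slope \<alpha> r + \<alpha> * r powr (\<alpha> - 2) * r' * p x)
      - (q' * r powr \<alpha> + \<alpha> * r powr (\<alpha> - 1) * r' * q x) = p' * div_slope \<alpha> r - q' * r powr \<alpha>" by simp
  thus ?thesis
    unfolding div_term_def
    using DERIV_diff[OF DERIV_mult[OF p S] DERIV_mult[OF q W]] by (simp only: r_def)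
qed

lemma has_real_derivative_div_lift:
  assumes "\<alpha> \<noteq> 1 \<Longrightarrow> 0 < (\<alpha> - 1) * F"
  shows "(div_lift \<alpha> has_real_derivative div_lift' \<alpha> F) (at F)"
proof (cases "\<alpha> = 1")
  case False
  hence "((\<lambda>F. 1 / (\<alpha> - 1) * ln ((\<alpha> - 1) * F)) has_real_derivative
      1 / (\<alpha> - 1) * (1 / ((\<alpha> - 1) * F) * (\<alpha> - 1))) (at F)"
    using assms by (intro DERIV_cmult DERIV_chain2[where f = ln] DERIV_ln_divide DERIV_cmult_Id) auto
  thus ?thesis using False by (simp add: div_lift_def[abs_def] div_lift'_def)
qed (simp add: div_lift_def[abs_def] div_lift'_def)

definition pvm_total where
  "pvm_total \<alpha> \<rho> \<sigma> P = (\<Sum>j\<in>UNIV. div_term \<alpha> (outcome_prob \<rho> (P $ j)) (outcome_prob \<sigma> (P $ j)))"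

lemma rank_one_outcome_pos:
  "P \<in> rank_one_pvms \<Longrightarrow> pos_def \<rho> \<Longrightarrow> 0 < outcome_prob \<rho> (P $ j)"
  by (auto simp: rank_one_pvms_def pvm_of_basis_nth pos_def_outcome_pos)

lemma rank_one_outcome_sum:
  "P \<in> rank_one_pvms \<Longrightarrow> trace \<rho> = 1 \<Longrightarrow> (\<Sum>j\<in>UNIV. outcome_prob \<rho> (P $ j)) = 1"
  by (auto simp: rank_one_pvms_def pvm_of_basis_nth outcome_prob_basis_sum)

lemma rank_one_divergence:
  assumes "P \<in> rank_one_pvms" "pos_def \<rho>" "pos_def \<sigma>"
  shows "pvm_divergence \<alpha> \<rho> \<sigma> P = div_lift \<alpha> (pvm_total \<alpha> \<rho> \<sigma> P)"
  unfolding pvm_divergence_def pvm_total_def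
  using rank_one_outcome_pos[OF assms(1)] assms by (intro renyi_divergence_eq_lift) auto

lemma rank_one_total_pos:
  assumes "P \<in> rank_one_pvms" "pos_def \<rho>" "pos_def \<sigma>" "trace \<rho> = 1" "\<alpha> \<noteq> 1"
  shows "0 < (\<alpha> - 1) * pvm_total \<alpha> \<rho> \<sigma> P"
  unfolding pvm_total_def
  using rank_one_outcome_pos[OF assms(1)] assms by (intro div_sum_pos rank_one_outcome_sum) auto

definition pvm_differential where
  "pvm_differential \<alpha> \<rho> \<sigma> P v = div_lift' \<alpha> (pvm_total \<alpha> \<rho> \<sigma> P) *
     (\<Sum>j\<in>UNIV. outcome_prob \<rho> (v $ j) * div_slope \<alpha> (outcome_prob \<rho> (P $ j) / outcome_prob \<sigma> (P $ j))
        - outcome_prob \<sigma> (v $ j) * (outcome_prob \<rho> (P $ j) / outcome_prob \<sigma> (P $ j)) powr \<alpha>)"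

lemma linear_outcome_prob: "linear (outcome_prob \<rho>)"
  by (rule linearI)
    (simp_all add: outcome_prob_def matrix_add_ldistrib trace_add scaleR_matrix_mult trace_scaleR)

lemma bounded_linear_outcome_prob: "bounded_linear (outcome_prob \<rho>)"
  using linear_outcome_prob by (simp add: linear_conv_bounded_linear)

lemma has_real_derivative_pvm_total:
  assumes \<gamma>: "(\<gamma> has_vector_derivative v) (at x)" "\<gamma> x \<in> rank_one_pvms"
    and pd: "pos_def \<rho>" "pos_def \<sigma>"
  shows "((\<lambda>t. pvm_total \<alpha> \<rho> \<sigma> (\<gamma> t)) has_real_derivative
     (\<Sum>j\<in>UNIV. outcome_prob \<rho> (v $ j) * div_slope \<alpha> (outcome_prob \<rho> (\<gamma> x $ j) / outcome_prob \<sigma> (\<gamma> x $ j))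
        - outcome_prob \<sigma> (v $ j) * (outcome_prob \<rho> (\<gamma> x $ j) / outcome_prob \<sigma> (\<gamma> x $ j)) powr \<alpha>)) (at x)"
proof -
  have "((\<lambda>t. outcome_prob A (\<gamma> t $ j)) has_real_derivative outcome_prob A (v $ j)) (at x)" for A j
    unfolding has_real_derivative_iff_has_vector_derivative
    using \<gamma>(1) by (intro bounded_linear.has_vector_derivative[OF bounded_linear_outcome_prob]
        bounded_linear.has_vector_derivative[OF bounded_linear_vec_nth])
  thus ?thesis
    unfolding pvm_total_def
    using rank_one_outcome_pos[OF \<gamma>(2)] pd by (intro DERIV_sum has_real_derivative_div_term) auto
qed

lemma has_real_derivative_pvm_divergence:
  assumes \<gamma>: "(\<gamma> has_vector_derivative v) (at x)" "\<And>t. \<gamma> t \<in> rank_one_pvms"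
    and pd: "pos_def \<rho>" "pos_def \<sigma>" "trace \<rho> = 1"
  shows "((\<lambda>t. pvm_divergence \<alpha> \<rho> \<sigma> (\<gamma> t)) has_real_derivative pvm_differential \<alpha> \<rho> \<sigma> (\<gamma> x) v) (at x)"
  unfolding rank_one_divergence[OF \<gamma>(2) pd(1,2)] pvm_differential_def
  by (rule DERIV_chain2[where f = "div_lift \<alpha>", OF has_real_derivative_div_lift
        has_real_derivative_pvm_total[OF \<gamma>(1,2) pd(1,2)]])
     (rule rank_one_total_pos[OF \<gamma>(2) pd])

section \<open>The divergence along a fixed two-level rotation\<close>

locale two_level =
  fixes \<alpha> :: real and \<rho> \<sigma> :: "complex^'d^'d" and b :: "'d \<Rightarrow> complex^'d" and j k :: 'd and \<phi> :: real
  assumes \<alpha>: "\<alpha> > 0" and \<rho>: "pos_def \<rho>" "trace \<rho> = 1" and \<sigma>: "pos_def \<sigma>"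
    and b: "orthonormal_basis b" and jk: "j \<noteq> k"
begin

definition curve where "curve \<theta> = pvm_of_basis (two_level_rotation b j k \<phi> \<theta>)"

lemma curve_mem: "curve \<theta> \<in> rank_one_pvms"
  unfolding curve_def rank_one_pvms_def using two_level_rotation_orthonormal[OF b jk] by blast

lemma curve_0: "curve 0 = pvm_of_basis b"
  by (simp add: curve_def two_level_rotation_0[OF jk])

definition frame' where
  "frame' \<theta> i = (if i = j then - sin \<theta> *\<^sub>R b j + cos \<theta> *\<^sub>R (cis \<phi> *s b k)
     else if i = k then - sin \<theta> *\<^sub>R b k - cos \<theta> *\<^sub>R (cis (- \<phi>) *s b j) else 0)"

definition curve' where
  "curve' \<theta> = (\<chi> i. ket_bra2 (two_level_rotation b j k \<phi> \<theta> i) (frame' \<theta> i)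
     + ket_bra2 (frame' \<theta> i) (two_level_rotation b j k \<phi> \<theta> i))"

lemma frame_derivative:
  "((\<lambda>\<theta>. two_level_rotation b j k \<phi> \<theta> i) has_vector_derivative frame' \<theta> i) (at \<theta>)"
  using has_vector_derivative_rotation[OF jk, of "\<lambda>_. b" "\<lambda>_. 0" \<theta> \<phi> 1 i]
  by (auto simp: frame'_def if_distrib split: if_splits)

lemma curve_derivative: "(curve has_vector_derivative curve' \<theta>) (at \<theta>)"
  unfolding curve_def[abs_def] curve'_def
  by (rule has_vector_derivative_pvm_of_basis[OF frame_derivative])

lemma frame'_differentiable: "\<exists>D. \<forall>i. ((\<lambda>\<theta>. frame' \<theta> i) has_vector_derivative D i) (at \<theta>)"
proof -
  have "\<exists>d. ((\<lambda>\<theta>. frame' \<theta> i) has_vector_derivative d) (at \<theta>)" for i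
  proof -
    have C: "(cos has_real_derivative - sin \<theta>) (at \<theta>)"
      and S: "((\<lambda>t. - sin t) has_real_derivative - cos \<theta>) (at \<theta>)"
      by (auto intro!: derivative_eq_intros)
    define u where "u = (if i = j then b j else if i = k then b k else 0)"
    define w where "w = (if i = j then cis \<phi> *s b k else if i = k then - (cis (- \<phi>) *s b j) else 0)"
    have "(\<lambda>\<theta>. frame' \<theta> i) = (\<lambda>\<theta>. - sin \<theta> *\<^sub>R u + cos \<theta> *\<^sub>R w)"
      using jk by (auto simp: frame'_def u_def w_def fun_eq_iff)
    thus ?thesis
      using has_vector_derivative_add[OF has_vector_derivative_scaleR[OF S has_vector_derivative_const]
          has_vector_derivative_scaleR[OF C has_vector_derivative_const]] by auto
  qed
  thus ?thesis by metis
qed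

lemma curve'_differentiable: "\<exists>D. (curve' has_vector_derivative D) (at \<theta>)"
proof -
  obtain D where D: "\<And>i. ((\<lambda>\<theta>. frame' \<theta> i) has_vector_derivative D i) (at \<theta>)"
    using frame'_differentiable by metis
  have "(curve' has_vector_derivative (\<chi> i.
      (ket_bra2 (two_level_rotation b j k \<phi> \<theta> i) (D i) + ket_bra2 (frame' \<theta> i) (frame' \<theta> i))
      + (ket_bra2 (frame' \<theta> i) (frame' \<theta> i) + ket_bra2 (D i) (two_level_rotation b j k \<phi> \<theta> i)))) (at \<theta>)"
  proof (rule has_vector_derivative_vecI)
    fix i
    show "((\<lambda>t. curve' t $ i) has_vector_derivative (\<chi> i.
      (ket_bra2 (two_level_rotation b j k \<phi> \<theta> i) (D i) + ket_bra2 (frame' \<theta> i) (frame' \<theta> i))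
      + (ket_bra2 (frame' \<theta> i) (frame' \<theta> i) + ket_bra2 (D i) (two_level_rotation b j k \<phi> \<theta> i))) $ i) (at \<theta>)"
      unfolding curve'_def vec_lambda_beta
      by (intro has_vector_derivative_add has_vector_derivative_ket_bra2 D frame_derivative)
  qed
  thus ?thesis by blast
qed

text \<open>The speed at which outcome \<open>j\<close> gains probability on \<open>A\<close>.
  Outcome \<open>k\<close> loses as much, which is why only differences between \<open>j\<close> and
  \<open>k\<close> enter \<open>numer\<close>.\<close>

definition rot_rate where
  "rot_rate A \<theta> = 2 * (Re (cis \<phi> * cinner (b j) (A *v b k)) * (cos \<theta> * cos \<theta> - sin \<theta> * sin \<theta>)
     + sin \<theta> * cos \<theta> * (outcome_prob A (ket_bra (b k)) - outcome_prob A (ket_bra (b j))))"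

lemma curve_prob_derivative:
  assumes "hermitian A"
  shows "((\<lambda>\<theta>. outcome_prob A (curve \<theta> $ i)) has_real_derivative
    (if i = j then rot_rate A \<theta> else if i = k then - rot_rate A \<theta> else 0)) (at \<theta>)"
proof -
  have "((\<lambda>\<theta>. (cos \<theta>)\<^sup>2 * p + (sin \<theta>)\<^sup>2 * q + 2 * sin \<theta> * cos \<theta> * r) has_real_derivative
     2 * (r * (cos \<theta> * cos \<theta> - sin \<theta> * sin \<theta>) + sin \<theta> * cos \<theta> * (q - p))) (at \<theta>)" for p q r :: real
    by (auto intro!: derivative_eq_intros simp: algebra_simps)
  moreover have "((\<lambda>\<theta>. (cos \<theta>)\<^sup>2 * q + (sin \<theta>)\<^sup>2 * p - 2 * sin \<theta> * cos \<theta> * r) has_real_derivative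
     - (2 * (r * (cos \<theta> * cos \<theta> - sin \<theta> * sin \<theta>) + sin \<theta> * cos \<theta> * (q - p)))) (at \<theta>)" for p q r :: real
    by (auto intro!: derivative_eq_intros simp: algebra_simps)
  ultimately show ?thesis
    using jk unfolding curve_def pvm_of_basis_nth outcome_prob_rotation[OF assms jk] rot_rate_def
    by auto
qed

definition ratio where "ratio i \<theta> = outcome_prob \<rho> (curve \<theta> $ i) / outcome_prob \<sigma> (curve \<theta> $ i)"

definition numer where
  "numer \<theta> = (div_slope \<alpha> (ratio j \<theta>) - div_slope \<alpha> (ratio k \<theta>)) * rot_rate \<rho> \<theta>
     - (ratio j \<theta> powr \<alpha> - ratio k \<theta> powr \<alpha>) * rot_rate \<sigma> \<theta>"

definition rate where
  "rate \<theta> = div_lift' \<alpha> (pvm_total \<alpha> \<rho> \<sigma> (curve \<theta>)) * numer \<theta>"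

lemma herm: "hermitian \<rho>" "hermitian \<sigma>"
  using \<rho> \<sigma> by (auto simp: pos_def_def)

lemma total_derivative:
  "((\<lambda>\<theta>. pvm_total \<alpha> \<rho> \<sigma> (curve \<theta>)) has_real_derivative numer \<theta>) (at \<theta>)"
proof -
  have "((\<lambda>\<theta>. pvm_total \<alpha> \<rho> \<sigma> (curve \<theta>)) has_real_derivative
     (\<Sum>i\<in>UNIV. (if i = j then rot_rate \<rho> \<theta> else if i = k then - rot_rate \<rho> \<theta> else 0) * div_slope \<alpha> (ratio i \<theta>)
        - (if i = j then rot_rate \<sigma> \<theta> else if i = k then - rot_rate \<sigma> \<theta> else 0) * ratio i \<theta> powr \<alpha>)) (at \<theta>)"
    unfolding pvm_total_def ratio_def
    using rank_one_outcome_pos[OF curve_mem] \<rho> \<sigma>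
    by (intro DERIV_sum has_real_derivative_div_term curve_prob_derivative herm) auto
  also have "(\<Sum>i\<in>UNIV. (if i = j then rot_rate \<rho> \<theta> else if i = k then - rot_rate \<rho> \<theta> else 0) * div_slope \<alpha> (ratio i \<theta>)
        - (if i = j then rot_rate \<sigma> \<theta> else if i = k then - rot_rate \<sigma> \<theta> else 0) * ratio i \<theta> powr \<alpha>)
      = (\<Sum>i\<in>{j, k}. (if i = j then rot_rate \<rho> \<theta> else if i = k then - rot_rate \<rho> \<theta> else 0) * div_slope \<alpha> (ratio i \<theta>)
        - (if i = j then rot_rate \<sigma> \<theta> else if i = k then - rot_rate \<sigma> \<theta> else 0) * ratio i \<theta> powr \<alpha>)"
    by (rule sum.mono_neutral_right) auto
  also have "\<dots> = numer \<theta>"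
    using jk by (simp add: numer_def algebra_simps)
  finally show ?thesis .
qed

lemma divergence_derivative:
  "((\<lambda>\<theta>. pvm_divergence \<alpha> \<rho> \<sigma> (curve \<theta>)) has_real_derivative rate \<theta>) (at \<theta>)"
  unfolding rank_one_divergence[OF curve_mem \<rho>(1) \<sigma>] rate_def
  by (rule DERIV_chain2[where f = "div_lift \<alpha>", OF has_real_derivative_div_lift total_derivative])
     (rule rank_one_total_pos[OF curve_mem \<rho>(1) \<sigma> \<rho>(2)])

lemma lift'_pos: "0 < div_lift' \<alpha> (pvm_total \<alpha> \<rho> \<sigma> (curve \<theta>))"
  using rank_one_total_pos[OF curve_mem \<rho>(1) \<sigma> \<rho>(2), of \<alpha>] by (simp add: div_lift'_def)

lemma ratio_0: "ratio i 0 = likelihood_ratio \<rho> \<sigma> b i"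
  by (simp add: ratio_def likelihood_ratio_def curve_0 pvm_of_basis_nth)

lemma ratio_pos: "ratio i \<theta> > 0"
  using rank_one_outcome_pos[OF curve_mem] \<rho> \<sigma> by (simp add: ratio_def)

lemma rate_0:
  "rate 0 = 0 \<longleftrightarrow> Re (cis \<phi> *
     (of_real (div_slope \<alpha> (likelihood_ratio \<rho> \<sigma> b j) - div_slope \<alpha> (likelihood_ratio \<rho> \<sigma> b k)) * cinner (b j) (\<rho> *v b k)
      - of_real (likelihood_ratio \<rho> \<sigma> b j powr \<alpha> - likelihood_ratio \<rho> \<sigma> b k powr \<alpha>) * cinner (b j) (\<sigma> *v b k))) = 0"
proof -
  have "numer 0 = 2 * Re (cis \<phi> *
     (of_real (div_slope \<alpha> (ratio j 0) - div_slope \<alpha> (ratio k 0)) * cinner (b j) (\<rho> *v b k)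
      - of_real (ratio j 0 powr \<alpha> - ratio k 0 powr \<alpha>) * cinner (b j) (\<sigma> *v b k)))"
    by (simp add: numer_def rot_rate_def algebra_simps)
  thus ?thesis using lift'_pos[of 0] unfolding rate_def ratio_0 by simp
qed

text \<open>At equal ratios both differences in \<open>numer\<close> vanish, so the product rule
  keeps only their derivatives. The ratios move at speeds d / q_j and -d / q_k with d twice the real
  part in the hypothesis, and the outcome is \<alpha> t^(\<alpha> - 2) (1/q_j + 1/q_k) d^2 times the
  positive lift factor. The derivative of that factor meets \<open>numer 0 = 0\<close>.\<close>

lemma rate_derivative:
  assumes t: "likelihood_ratio \<rho> \<sigma> b j = t" "likelihood_ratio \<rho> \<sigma> b k = t"
    and a: "Re (cis \<phi> * cinner (b j) ((\<rho> - t *\<^sub>R \<sigma>) *v b k)) \<noteq> 0"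
  shows "\<exists>D>0. (rate has_real_derivative D) (at 0)"
proof -
  define L where "L \<theta> = div_lift' \<alpha> (pvm_total \<alpha> \<rho> \<sigma> (curve \<theta>))" for \<theta>
  define q where "q i = outcome_prob \<sigma> (curve 0 $ i)" for i
  define d where "d = rot_rate \<rho> 0 - t * rot_rate \<sigma> 0"
  have q: "q i > 0" for i
    unfolding q_def by (rule rank_one_outcome_pos[OF curve_mem \<sigma>])
  have pq: "outcome_prob \<rho> (curve 0 $ i) = t * q i" if "i \<in> {j, k}" for i
    using that t q[of i] ratio_0[of i] unfolding ratio_def q_def[symmetric] by (auto simp: field_simps)
  have tpos: "t > 0" using ratio_pos[of j 0] t by (simp add: ratio_0)
  have "d = 2 * Re (cis \<phi> * cinner (b j) ((\<rho> - t *\<^sub>R \<sigma>) *v b k))"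
    by (simp add: d_def rot_rate_def matrix_vector_mult_diff_rdistrib cinner_diff_right scaleR_mult_vec
        cinner_scaleR_right algebra_simps)
  hence d: "d \<noteq> 0" using a by simp
  have rj: "(ratio j has_real_derivative d / q j) (at 0)"
  proof -
    have "(ratio j has_real_derivative (rot_rate \<rho> 0 * q j - t * q j * rot_rate \<sigma> 0) / (q j * q j)) (at 0)"
      using DERIV_divide[OF curve_prob_derivative[OF herm(1), of j 0] curve_prob_derivative[OF herm(2), of j 0]]
        q[of j] pq[of j] by (simp add: ratio_def[abs_def] q_def)
    moreover have "(rot_rate \<rho> 0 * q j - t * q j * rot_rate \<sigma> 0) / (q j * q j) = d / q j"
      using q[of j] by (simp add: d_def field_simps)
    ultimately show ?thesis by (simp only:)
  qed
  have rk: "(ratio k has_real_derivative - d / q k) (at 0)"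
  proof -
    have "(ratio k has_real_derivative (- rot_rate \<rho> 0 * q k - t * q k * (- rot_rate \<sigma> 0)) / (q k * q k)) (at 0)"
      using DERIV_divide[OF curve_prob_derivative[OF herm(1), of k 0] curve_prob_derivative[OF herm(2), of k 0]]
        q[of k] pq[of k] jk by (simp add: ratio_def[abs_def] q_def)
    moreover have "(- rot_rate \<rho> 0 * q k - t * q k * (- rot_rate \<sigma> 0)) / (q k * q k) = - d / q k"
      using q[of k] by (simp add: d_def field_simps)
    ultimately show ?thesis by (simp only:)
  qed
  have r0: "ratio j 0 = t" "ratio k 0 = t" using t by (simp_all add: ratio_0)
  have sl: "((\<lambda>\<theta>. div_slope \<alpha> (ratio i \<theta>)) has_real_derivative \<alpha> * t powr (\<alpha> - 2) * r') (at 0)"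
    and pw: "((\<lambda>\<theta>. ratio i \<theta> powr \<alpha>) has_real_derivative \<alpha> * t powr (\<alpha> - 1) * r') (at 0)"
    if "(ratio i has_real_derivative r') (at 0)" "ratio i 0 = t" for i r'
    using that(2) tpos
    by (auto intro!: DERIV_chain2[where f = "div_slope \<alpha>", OF _ that(1)] has_real_derivative_div_slope
        DERIV_chain2[where f = "\<lambda>y. y powr \<alpha>", OF _ that(1)] has_real_derivative_powr)
  have rr: "\<exists>d. (rot_rate A has_real_derivative d) (at 0)" for A
    unfolding rot_rate_def[abs_def] by (rule exI) (auto intro!: derivative_eq_intros)
  obtain r1 s1 where r1: "(rot_rate \<rho> has_real_derivative r1) (at 0)"
    and s1: "(rot_rate \<sigma> has_real_derivative s1) (at 0)" using rr by metis
  have "(numer has_real_derivative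
     (\<alpha> * t powr (\<alpha> - 2) * (d / q j) - \<alpha> * t powr (\<alpha> - 2) * (- d / q k)) * rot_rate \<rho> 0
     - (\<alpha> * t powr (\<alpha> - 1) * (d / q j) - \<alpha> * t powr (\<alpha> - 1) * (- d / q k)) * rot_rate \<sigma> 0) (at 0)"
    unfolding numer_def[abs_def]
    using DERIV_diff[OF DERIV_mult[OF DERIV_diff[OF sl[OF rj r0(1)] sl[OF rk r0(2)]] r1]
        DERIV_mult[OF DERIV_diff[OF pw[OF rj r0(1)] pw[OF rk r0(2)]] s1]] r0 by simp
  moreover have "t powr (\<alpha> - 1) = t * t powr (\<alpha> - 2)"
    using tpos powr_add[of t 1 "\<alpha> - 2"] by simp
  ultimately have N: "(numer has_real_derivative \<alpha> * t powr (\<alpha> - 2) * (1 / q j + 1 / q k) * d\<^sup>2) (at 0)"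
    by (simp add: d_def algebra_simps power2_eq_square diff_divide_distrib add_divide_distrib)
  have N0: "numer 0 = 0" by (simp add: numer_def r0)
  have "\<exists>d. (L has_real_derivative d) (at 0)"
  proof (cases "\<alpha> = 1")
    case False
    show ?thesis
      unfolding L_def[abs_def] div_lift'_def using False rank_one_total_pos[OF curve_mem \<rho>(1) \<sigma> \<rho>(2) False, of 0]
      by (intro exI) (auto intro!: derivative_eq_intros total_derivative)
  qed (auto simp: L_def[abs_def] div_lift'_def intro!: exI[of _ 0])
  then obtain l where "(L has_real_derivative l) (at 0)" by blast
  from DERIV_mult[OF this N] N0
  have "(rate has_real_derivative L 0 * (\<alpha> * t powr (\<alpha> - 2) * (1 / q j + 1 / q k) * d\<^sup>2)) (at 0)"
    unfolding rate_def[abs_def] L_def[symmetric] by (simp add: mult.commute)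
  moreover have "0 < L 0 * (\<alpha> * t powr (\<alpha> - 2) * (1 / q j + 1 / q k) * d\<^sup>2)"
    unfolding L_def using lift'_pos[of 0] \<alpha> tpos q d by (intro mult_pos_pos add_pos_pos) auto
  ultimately show ?thesis by blast
qed

end


section \<open>First-order stationarity and local maxima\<close>

text \<open>Stationarity along all two-level rotations yields the clause of \<open>balanced\<close>
  for unequal ratios. A non-optimal basis must therefore violate the clause for equal ratios, and
  the violating pair is the two-level direction sought.\<close>

lemma not_optimal_two_level:
  fixes \<rho> \<sigma> :: "complex^'d^'d"
  assumes \<rho>: "faithful_density_operator \<rho>" and \<sigma>: "faithful_density_operator \<sigma>" and \<alpha>: "\<alpha> > 0"
    and b: "orthonormal_basis b"
    and stat: "\<And>j k \<phi>. j \<noteq> k \<Longrightarrow> ((\<lambda>\<theta>. pvm_divergence \<alpha> \<rho> \<sigma> (pvm_of_basis (two_level_rotation b j k \<phi> \<theta>)))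
      has_real_derivative 0) (at 0)"
    and no: "\<not> globally_optimal \<alpha> \<rho> \<sigma> (pvm_of_basis b)"
  shows "admits_two_level_increase \<alpha> \<rho> \<sigma> b"
proof -
  note f = faithful_simps[OF \<rho>] faithful_simps(1)[OF \<sigma>]
  let ?x = "likelihood_ratio \<rho> \<sigma> b"
  have tl: "two_level \<alpha> \<rho> \<sigma> b j k" if "j \<noteq> k" for j k
    using that \<alpha> f b by unfold_locales
  have crit: "of_real (div_slope \<alpha> (?x j) - div_slope \<alpha> (?x k)) * cinner (b j) (\<rho> *v b k)
      = of_real (?x j powr \<alpha> - ?x k powr \<alpha>) * cinner (b j) (\<sigma> *v b k)" if jk: "j \<noteq> k" for j k
  proof -
    interpret two_level \<alpha> \<rho> \<sigma> b j k \<phi> for \<phi> by (rule tl[OF jk])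
    let ?z = "of_real (div_slope \<alpha> (?x j) - div_slope \<alpha> (?x k)) * cinner (b j) (\<rho> *v b k)
      - of_real (?x j powr \<alpha> - ?x k powr \<alpha>) * cinner (b j) (\<sigma> *v b k)"
    have "rate \<phi> 0 = 0" for \<phi>
      using DERIV_unique[OF divergence_derivative[of \<phi> 0, unfolded curve_def] stat[OF jk, of \<phi>]] .
    hence z: "Re (cis \<phi> * ?z) = 0" for \<phi> unfolding rate_0 by blast
    \<comment> \<open>The phases 0 and pi/2 give the real and the imaginary part of the complex
      criticality equation.\<close>
    have "Re ?z = 0" using z[of 0] by (simp only: cis_zero mult_1_left)
    moreover have "Im ?z = 0" using z[of "pi / 2"]
      by (simp only: cis_pi_half times_complex.sel imaginary_unit.sel mult_zero_left mult_1_left)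
    ultimately have "?z = 0" by (simp only: complex_eq_iff zero_complex.sel)
    thus ?thesis by simp
  qed
  have "\<not> balanced \<alpha> \<rho> \<sigma> b"
    using no balanced_optimal[OF \<alpha> b _ \<rho> \<sigma>] by blast
  then obtain j k where jk: "j \<noteq> k" and eq: "?x j = ?x k"
    and ne: "cinner (b j) (\<rho> *v b k) \<noteq> of_real (?x j) * cinner (b j) (\<sigma> *v b k)"
    unfolding balanced_def Let_def using crit by meson
  define a where "a = cinner (b j) ((\<rho> - ?x j *\<^sub>R \<sigma>) *v b k)"
  have a: "a \<noteq> 0"
    using ne by (simp add: a_def matrix_vector_mult_diff_rdistrib cinner_diff_right scaleR_mult_vec
        cinner_scaleR_right)
  interpret two_level \<alpha> \<rho> \<sigma> b j k "- Arg a" by (rule tl[OF jk])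
  \<comment> \<open>This phase turns \<open>a\<close> into |a|, so the real part on which
    \<open>rate_derivative\<close> depends is nonzero.\<close>
  have "cis (- Arg a) * a = of_real (cmod a)"
  proof -
    have "cis (- Arg a) * a = cis (- Arg a) * (of_real (cmod a) * cis (Arg a))"
      using rcis_cmod_Arg[of a] by (simp only: rcis_def)
    thus ?thesis by (simp add: cis_mult mult.left_commute)
  qed
  hence "Re (cis (- Arg a) * a) \<noteq> 0" using a by simp
  then obtain D where D: "D > 0" "(rate has_real_derivative D) (at 0)"
    using rate_derivative[OF refl eq[symmetric]] unfolding a_def by blast
  have "has_pos_second_derivative_at_0 (\<lambda>\<theta>. pvm_divergence \<alpha> \<rho> \<sigma> (curve \<theta>))"
    unfolding has_pos_second_derivative_at_0_def
    using D divergence_derivative by (intro exI[of _ rate] exI[of _ D]) auto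
  note inc = this
  show ?thesis
    unfolding admits_two_level_increase_def
  proof (rule exI[of _ j], rule exI[of _ k], rule exI[of _ "?x j"], rule exI[of _ a], intro conjI)
    show "has_pos_second_derivative_at_0
        (\<lambda>\<theta>. pvm_divergence \<alpha> \<rho> \<sigma> (pvm_of_basis (two_level_rotation b j k (- Arg a) \<theta>)))"
      using inc by (simp only: curve_def)
    show "outcome_prob \<rho> (ket_bra (b k)) / outcome_prob \<sigma> (ket_bra (b k)) = ?x j"
      unfolding eq by (rule likelihood_ratio_def[symmetric])
  qed (fact jk a a_def likelihood_ratio_def[symmetric])+
qed

text \<open>Since g' vanishes at 0 and has positive slope there, it is positive just to the right,
  and the mean value theorem makes g exceed \<open>g 0\<close>.\<close>

lemma pos_second_derivative_not_local_max:
  fixes g :: "real \<Rightarrow> real"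
  assumes g: "has_pos_second_derivative_at_0 g" and max: "\<forall>\<^sub>F x in nhds 0. g x \<le> g 0"
  shows False
proof -
  from g obtain g' D where g': "\<forall>\<^sub>F x in nhds 0. (g has_real_derivative g' x) (at x)"
    and D: "(g' has_real_derivative D) (at 0)" "0 < D"
    unfolding has_pos_second_derivative_at_0_def by blast
  from g' max have "\<forall>\<^sub>F x in nhds 0. (g has_real_derivative g' x) (at x) \<and> g x \<le> g 0"
    by (rule eventually_conj)
  then obtain e where e: "e > 0" "\<And>x. \<bar>x\<bar> < e \<Longrightarrow> (g has_real_derivative g' x) (at x) \<and> g x \<le> g 0"
    unfolding eventually_nhds_metric by (auto simp: dist_real_def)
  have "g' 0 = 0"
    by (rule DERIV_local_max[of g "g' 0" 0 e]) (use e in auto)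
  with DERIV_pos_inc_right[OF D] obtain d where d: "d > 0" "\<And>h. 0 < h \<Longrightarrow> h < d \<Longrightarrow> 0 < g' h"
    by auto
  define x where "x = min e d / 2"
  have x: "0 < x" "x < e" "x < d" using e(1) d(1) by (auto simp: x_def)
  have "\<exists>z. 0 < z \<and> z < x \<and> g x - g 0 = (x - 0) * g' z"
    using x e by (intro MVT2) auto
  then obtain z where z: "0 < z" "z < x" "g x - g 0 = x * g' z" by auto
  have "0 < x * g' z" using d(2)[of z] z x by (intro mult_pos_pos) auto
  hence "g x > g 0" using z(3) by linarith
  thus False using e(2)[of x] x by simp
qed

text \<open>The filter \<open>at x within M\<close> omits x, where the inequality is trivial. With x
  restored, it pulls back along the curve, which may return to x at other times.\<close>

lemma local_maximum_along_curve:
  fixes \<gamma> :: "real \<Rightarrow> 'a::t2_space"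
  assumes max: "local_maximum_on M f (\<gamma> 0)" and \<gamma>: "\<And>t. \<gamma> t \<in> M" "isCont \<gamma> 0"
  shows "\<forall>\<^sub>F t in nhds 0. f (\<gamma> t) \<le> f (\<gamma> 0)"
proof -
  have "\<forall>\<^sub>F y in nhds (\<gamma> 0). y \<in> M \<longrightarrow> f y \<le> f (\<gamma> 0)"
  proof -
    have "\<forall>\<^sub>F y in nhds (\<gamma> 0). y \<noteq> \<gamma> 0 \<longrightarrow> y \<in> M \<longrightarrow> f y \<le> f (\<gamma> 0)"
      using max by (simp add: local_maximum_on_def eventually_at_filter)
    thus ?thesis by eventually_elim auto
  qed
  moreover have "filterlim \<gamma> (nhds (\<gamma> 0)) (nhds 0)"
    using \<gamma>(2) unfolding isCont_def by (simp add: tendsto_at_iff_tendsto_nhds)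
  ultimately have "\<forall>\<^sub>F t in nhds 0. \<gamma> t \<in> M \<longrightarrow> f (\<gamma> t) \<le> f (\<gamma> 0)"
    using filterlim_iff by blast
  thus ?thesis by eventually_elim (use \<gamma>(1) in auto)
qed

lemma local_maximum_optimal:
  fixes \<rho> \<sigma> :: "complex^'d^'d"
  assumes \<rho>: "faithful_density_operator \<rho>" and \<sigma>: "faithful_density_operator \<sigma>" and \<alpha>: "\<alpha> > 0"
    and b: "orthonormal_basis b"
    and max: "local_maximum_on rank_one_pvms (pvm_divergence \<alpha> \<rho> \<sigma>) (pvm_of_basis b)"
  shows "globally_optimal \<alpha> \<rho> \<sigma> (pvm_of_basis b)"
proof (rule ccontr)
  assume no: "\<not> globally_optimal \<alpha> \<rho> \<sigma> (pvm_of_basis b)"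
  note f = faithful_simps[OF \<rho>] faithful_simps(1)[OF \<sigma>]
  have tl: "two_level \<alpha> \<rho> \<sigma> b j k" if "j \<noteq> k" for j k
    using that \<alpha> f b by unfold_locales
  let ?g = "\<lambda>j k \<phi> \<theta>. pvm_divergence \<alpha> \<rho> \<sigma> (pvm_of_basis (two_level_rotation b j k \<phi> \<theta>))"
  have ev: "\<forall>\<^sub>F \<theta> in nhds 0. ?g j k \<phi> \<theta> \<le> ?g j k \<phi> 0" if jk: "j \<noteq> k" for j k \<phi>
  proof -
    interpret two_level \<alpha> \<rho> \<sigma> b j k \<phi> by (rule tl[OF jk])
    have "isCont curve 0"
      using has_vector_derivative_continuous[OF curve_derivative[of 0]] .
    from local_maximum_along_curve[OF _ curve_mem this, of "pvm_divergence \<alpha> \<rho> \<sigma>"] max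
    show ?thesis by (simp add: curve_0) (simp add: curve_def two_level_rotation_0[OF jk])
  qed
  have "(?g j k \<phi> has_real_derivative 0) (at 0)" if jk: "j \<noteq> k" for j k \<phi>
  proof -
    interpret two_level \<alpha> \<rho> \<sigma> b j k \<phi> by (rule tl[OF jk])
    obtain e where e: "e > 0" "\<And>x. \<bar>x\<bar> < e \<Longrightarrow> ?g j k \<phi> x \<le> ?g j k \<phi> 0"
      using ev[OF jk, of \<phi>] unfolding eventually_nhds_metric by (auto simp: dist_real_def)
    note d = divergence_derivative[of 0, unfolded curve_def]
    have "rate 0 = 0" by (rule DERIV_local_max[OF d e(1)]) (use e(2) in auto)
    thus ?thesis using d by simp
  qed
  from not_optimal_two_level[OF \<rho> \<sigma> \<alpha> b this no]
  obtain j k \<phi> where jk: "j \<noteq> k" and pos: "has_pos_second_derivative_at_0 (?g j k \<phi>)"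
    unfolding admits_two_level_increase_def by auto
  show False by (rule pos_second_derivative_not_local_max[OF pos ev[OF jk]])
qed

lemma critical_rotation:
  fixes \<rho> \<sigma> :: "complex^'d^'d"
  assumes \<rho>: "faithful_density_operator \<rho>" and \<sigma>: "faithful_density_operator \<sigma>" and \<alpha>: "\<alpha> > 0"
    and b: "orthonormal_basis b" and jk: "j \<noteq> k"
    and crit: "critical_on rank_one_pvms (pvm_divergence \<alpha> \<rho> \<sigma>) (pvm_of_basis b)"
  shows "((\<lambda>\<theta>. pvm_divergence \<alpha> \<rho> \<sigma> (pvm_of_basis (two_level_rotation b j k \<phi> \<theta>)))
      has_real_derivative 0) (at 0)"
proof -
  interpret two_level \<alpha> \<rho> \<sigma> b j k \<phi>
    using \<alpha> faithful_simps[OF \<rho>] faithful_simps(1)[OF \<sigma>] b jk by unfold_locales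
  have "curve_in rank_one_pvms (pvm_of_basis b) (curve' 0) curve"
    unfolding curve_in_def using curve_mem curve_0 curve_derivative by auto
  thus ?thesis
    using crit unfolding critical_on_def tangent_space_def has_derivative_along_def
      has_real_derivative_iff_has_vector_derivative curve_def[symmetric] by blast
qed

section \<open>The Riemannian gradient and Hessian\<close>

lemma bounded_bilinear_matrix_mult: "bounded_bilinear ((**) :: complex^'d^'d \<Rightarrow> complex^'d^'d \<Rightarrow> complex^'d^'d)"
  unfolding bilinear_conv_bounded_bilinear[symmetric] bilinear_def
  by (auto intro!: linearI simp: matrix_add_ldistrib matrix_mult_distrib_right scaleR_matrix_mult)

lemma adjoint_mat_mult: "adjoint_mat (A ** B) = adjoint_mat B ** adjoint_mat A"
  by (simp add: adjoint_mat_def matrix_matrix_mult_def vec_eq_iff mult.commute)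

lemma adjoint_mat_add: "adjoint_mat (A + B) = adjoint_mat A + adjoint_mat B"
  by (simp add: adjoint_mat_def vec_eq_iff)

lemma adjoint_mat_diff: "adjoint_mat (A - B) = adjoint_mat A - adjoint_mat B"
  by (simp add: adjoint_mat_def vec_eq_iff)

lemma adjoint_mat_scaleR: "adjoint_mat (r *\<^sub>R A) = r *\<^sub>R adjoint_mat A"
  by (simp add: adjoint_mat_def vec_eq_iff)

lemma adjoint_mat_sum: "adjoint_mat (\<Sum>j\<in>S. f j) = (\<Sum>j\<in>S. adjoint_mat (f j))"
  by (simp add: adjoint_mat_def vec_eq_iff)

lemma hermitian_diff: "hermitian A \<Longrightarrow> hermitian B \<Longrightarrow> hermitian (A - B)"
  by (simp add: hermitian_def adjoint_mat_diff)

lemma hermitian_scaleR: "hermitian A \<Longrightarrow> hermitian (r *\<^sub>R A)"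
  by (simp add: hermitian_def adjoint_mat_scaleR)

text \<open>Translates the ambient metric Re Tr(A* B) into \<open>outcome_prob\<close>, in which the
  first derivative of the divergence is expressed.\<close>

lemma inner_hermitian:
  assumes "hermitian A"
  shows "A \<bullet> B = outcome_prob A B"
proof -
  have "A \<bullet> B = (\<Sum>r\<in>UNIV. \<Sum>c\<in>UNIV. Re (cnj (A $ r $ c) * B $ r $ c))"
    by (simp add: inner_vec_def inner_complex_def)
  also have "\<dots> = (\<Sum>r\<in>UNIV. \<Sum>c\<in>UNIV. Re (A $ c $ r * B $ r $ c))"
    by (simp only: hermitian_nth[OF assms])
  also have "\<dots> = outcome_prob A B"
    unfolding outcome_prob_def trace_def matrix_matrix_mult_def vec_lambda_beta Re_sum by (rule sum.swap)
  finally show ?thesis .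
qed

lemma ket_bra_mult: "ket_bra u ** ket_bra w = ket_bra2 (cinner u w *s u) w"
  by (simp add: vec_eq_iff ket_bra_def ket_bra2_def matrix_matrix_mult_def cinner_def
      sum_distrib_left sum_distrib_right mult_ac)

lemma ket_bra_mult_mult: "ket_bra u ** A ** ket_bra w = ket_bra2 (cinner u (A *v w) *s u) w"
proof -
  have "(ket_bra u ** A) $ r $ i = u $ r * (\<Sum>l\<in>UNIV. cnj (u $ l) * A $ l $ i)" for r i
    by (simp add: ket_bra_def matrix_matrix_mult_def sum_distrib_left mult_ac)
  moreover have "cinner u (A *v w) = (\<Sum>i\<in>UNIV. (\<Sum>l\<in>UNIV. cnj (u $ l) * A $ l $ i) * w $ i)"
    unfolding cinner_mult_vec by (subst sum.swap) (simp add: sum_distrib_right)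
  ultimately show ?thesis
    by (simp add: vec_eq_iff matrix_matrix_mult_def[of "ket_bra u ** A"] ket_bra2_def
        ket_bra_def[of w] sum_distrib_left sum_distrib_right mult_ac)
qed

lemma rank_one_mult:
  assumes "P \<in> rank_one_pvms"
  shows "P $ j ** P $ k = (if j = k then P $ j else 0)"
proof -
  obtain b where b: "orthonormal_basis b" "P = pvm_of_basis b"
    using assms by (auto simp: rank_one_pvms_def)
  show ?thesis
    using b(1) unfolding b(2) pvm_of_basis_nth ket_bra_mult orthonormal_basis_def
    by (auto simp: ket_bra2_same[symmetric]) (simp add: ket_bra2_def vec_eq_iff)
qed

lemma rank_one_sum:
  assumes "P \<in> rank_one_pvms"
  shows "(\<Sum>j\<in>UNIV. P $ j) = mat 1"
  using assms by (auto simp: rank_one_pvms_def pvm_of_basis_nth orthonormal_basis_matrix)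

lemma hermitian_ket_bra: "hermitian (ket_bra v)"
  using pos_semidef_ket_bra[of v] by (simp add: pos_semidef_def)

lemma rank_one_hermitian: "P \<in> rank_one_pvms \<Longrightarrow> hermitian (P $ j)"
  by (auto simp: rank_one_pvms_def pvm_of_basis_nth hermitian_ket_bra)

text \<open>The product rule for the relations P_j P_k = 0 (j \<noteq> k) and P_j P_j = P_j along a
  curve of PVMs.\<close>

lemma tangent_mult:
  fixes P :: "complex^'d^'d^'d"
  assumes "v \<in> tangent_space rank_one_pvms P"
  shows "P $ j ** v $ k + v $ j ** P $ k = (if j = k then v $ j else 0)"
proof -
  obtain \<gamma> where \<gamma>: "\<And>t. \<gamma> t \<in> rank_one_pvms" "\<gamma> 0 = P" "(\<gamma> has_vector_derivative v) (at 0)"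
    using assms by (auto simp: tangent_space_def curve_in_def)
  have nth: "((\<lambda>t. \<gamma> t $ i) has_vector_derivative v $ i) (at 0)" for i
    by (rule bounded_linear.has_vector_derivative[OF bounded_linear_vec_nth \<gamma>(3)])
  have "((\<lambda>t. \<gamma> t $ j ** \<gamma> t $ k) has_vector_derivative P $ j ** v $ k + v $ j ** P $ k) (at 0)"
    using bounded_bilinear.has_vector_derivative[OF bounded_bilinear_matrix_mult nth[of j] nth[of k]] \<gamma>(2)
    by simp
  moreover have "((\<lambda>t. \<gamma> t $ j ** \<gamma> t $ k) has_vector_derivative (if j = k then v $ j else 0)) (at 0)"
    using nth[of j] by (auto simp: rank_one_mult[OF \<gamma>(1)])
  ultimately show ?thesis by (rule vector_derivative_unique_at)
qed

text \<open>The operator attached to outcome \<open>j\<close> in \<open>dual_operator\<close>, times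
  the derivative of the lift: the partial gradient of the divergence in the j-th projector.\<close>

definition pvm_force ::
  "real \<Rightarrow> complex^'d^'d \<Rightarrow> complex^'d^'d \<Rightarrow> complex^'d^'d^'d \<Rightarrow> 'd \<Rightarrow> complex^'d^'d" where
  "pvm_force \<alpha> \<rho> \<sigma> P j = div_lift' \<alpha> (pvm_total \<alpha> \<rho> \<sigma> P) *\<^sub>R
     (div_slope \<alpha> (outcome_prob \<rho> (P $ j) / outcome_prob \<sigma> (P $ j)) *\<^sub>R \<rho>
      - ((outcome_prob \<rho> (P $ j) / outcome_prob \<sigma> (P $ j)) powr \<alpha>) *\<^sub>R \<sigma>)"

lemma pvm_differential_force:
  "pvm_differential \<alpha> \<rho> \<sigma> P v = (\<Sum>j\<in>UNIV. outcome_prob (pvm_force \<alpha> \<rho> \<sigma> P j) (v $ j))"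
  by (simp add: pvm_differential_def pvm_force_def outcome_prob_scaleR_left outcome_prob_diff_left
      sum_distrib_left mult_ac)

text \<open>The orthogonal projection onto the tangent space of the ambient gradient, whose \<open>j\<close>-th component
  is the \<open>j\<close>-th force.\<close>

definition pvm_gradient ::
  "real \<Rightarrow> complex^'d^'d \<Rightarrow> complex^'d^'d \<Rightarrow> complex^'d^'d^'d \<Rightarrow> complex^'d^'d^'d" where
  "pvm_gradient \<alpha> \<rho> \<sigma> P = (\<chi> j. (1 / 2) *\<^sub>R (\<Sum>k\<in>UNIV.
     P $ j ** (pvm_force \<alpha> \<rho> \<sigma> P j - pvm_force \<alpha> \<rho> \<sigma> P k) ** P $ k
     + P $ k ** (pvm_force \<alpha> \<rho> \<sigma> P j - pvm_force \<alpha> \<rho> \<sigma> P k) ** P $ j))"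

lemma hermitian_force: "hermitian \<rho> \<Longrightarrow> hermitian \<sigma> \<Longrightarrow> hermitian (pvm_force \<alpha> \<rho> \<sigma> P j)"
  unfolding pvm_force_def by (intro hermitian_scaleR hermitian_diff)

lemma hermitian_gradient:
  assumes "P \<in> rank_one_pvms" "hermitian \<rho>" "hermitian \<sigma>"
  shows "hermitian (pvm_gradient \<alpha> \<rho> \<sigma> P $ j)"
  using rank_one_hermitian[OF assms(1)] hermitian_force[OF assms(2,3)]
  unfolding hermitian_def pvm_gradient_def
  by (simp add: adjoint_mat_scaleR adjoint_mat_sum adjoint_mat_add adjoint_mat_mult adjoint_mat_diff
      matrix_mul_assoc add.commute)

lemma outcome_prob_cyclic: "outcome_prob (A ** X ** B) v = outcome_prob X (B ** v ** A)"
  unfolding outcome_prob_def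
  by (metis matrix_mul_assoc trace_mul_sym)

lemma outcome_prob_add: "outcome_prob A (E + E') = outcome_prob A E + outcome_prob A E'"
  by (simp add: outcome_prob_def matrix_add_ldistrib trace_add)

lemma matrix_diff_mult: "(A - B) ** C = A ** C - B ** C" for A B C :: "complex^'d^'d"
  using matrix_mult_distrib_right[of "A - B" B C] by simp

lemma outcome_prob_diff: "outcome_prob A (E - E') = outcome_prob A E - outcome_prob A E'"
  using outcome_prob_add[of A "E - E'" E'] by simp

text \<open>The matrices \<open>B j k\<close> are antisymmetric in j, k and sum over k to v_j. In
  the double sum the terms with H_k thus reproduce those with H_j, which absorbs the factor 1/2 of
  \<open>pvm_gradient\<close>.\<close>

lemma gradient_inner:
  fixes P :: "complex^'d^'d^'d"
  assumes P: "P \<in> rank_one_pvms" and herm: "hermitian \<rho>" "hermitian \<sigma>"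
    and v: "v \<in> tangent_space rank_one_pvms P"
  shows "pvm_differential \<alpha> \<rho> \<sigma> P v = pvm_gradient \<alpha> \<rho> \<sigma> P \<bullet> v"
proof -
  define H where "H = pvm_force \<alpha> \<rho> \<sigma> P"
  define B where "B j k = v $ j ** P $ k - v $ k ** P $ j" for j k
  have zero: "0 ** A = 0" "A ** 0 = 0" for A :: "complex^'d^'d"
    by (simp_all add: matrix_matrix_mult_def vec_eq_iff)
  have PP: "P $ j ** (P $ k ** A) = (if j = k then P $ j ** A else 0)" for j k A
    by (simp add: matrix_mul_assoc rank_one_mult[OF P] zero)
  have PP': "A ** P $ j ** P $ k = (if j = k then A ** P $ j else 0)" for j k A
    by (simp flip: matrix_mul_assoc add: rank_one_mult[OF P] zero)
  \<comment> \<open>The left-hand side is the part of v_j in the blocks (k, j) and (j, k); the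
    tangency relations move one projector across and reveal the antisymmetry.\<close>
  have B: "P $ k ** v $ j ** P $ j + P $ j ** v $ j ** P $ k = B j k" for j k
  proof (cases "j = k")
    case True
    have "P $ j ** v $ j = v $ j - v $ j ** P $ j"
      using tangent_mult[OF v, of j j] by (simp add: algebra_simps)
    thus ?thesis using True by (simp add: B_def matrix_diff_mult PP')
  next
    case False
    have "P $ k ** v $ j = - (v $ k ** P $ j)" "P $ j ** v $ j = v $ j - v $ j ** P $ j"
      using tangent_mult[OF v, of k j] tangent_mult[OF v, of j j] False
      by (simp_all add: algebra_simps add_eq_0_iff)
    moreover have "- X ** Y = - (X ** Y)" for X Y :: "complex^'d^'d"
      using matrix_diff_mult[of 0 X Y] by (simp add: matrix_matrix_mult_def vec_eq_iff sum_negf)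
    ultimately show ?thesis using False by (simp add: B_def matrix_diff_mult PP')
  qed
  have sumB: "(\<Sum>k\<in>UNIV. B j k) = v $ j" for j
  proof -
    have "(\<Sum>k\<in>UNIV. B j k) = (\<Sum>k\<in>UNIV. P $ k) ** (v $ j ** P $ j) + P $ j ** v $ j ** (\<Sum>k\<in>UNIV. P $ k)"
      by (simp only: B[symmetric] sum.distrib matrix_mult_sum_left matrix_mult_sum_right matrix_mul_assoc)
    thus ?thesis using tangent_mult[OF v, of j j] by (simp add: rank_one_sum[OF P] add.commute)
  qed
  have "pvm_gradient \<alpha> \<rho> \<sigma> P \<bullet> v = (\<Sum>j\<in>UNIV. outcome_prob (pvm_gradient \<alpha> \<rho> \<sigma> P $ j) (v $ j))"
    by (simp only: inner_vec_def[of "pvm_gradient \<alpha> \<rho> \<sigma> P" v] inner_hermitian[OF hermitian_gradient[OF P herm]])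
  also have "\<dots> = (\<Sum>j\<in>UNIV. 1 / 2 * (\<Sum>k\<in>UNIV. outcome_prob (H j - H k) (B j k)))"
    by (simp only: pvm_gradient_def vec_lambda_beta outcome_prob_scaleR_left outcome_prob_sum_left
        outcome_prob_add_left outcome_prob_cyclic H_def[symmetric] outcome_prob_add[symmetric] B)
  also have "\<dots> = 1 / 2 * ((\<Sum>j\<in>UNIV. \<Sum>k\<in>UNIV. outcome_prob (H j) (B j k))
      - (\<Sum>j\<in>UNIV. \<Sum>k\<in>UNIV. outcome_prob (H k) (B j k)))"
    by (simp only: outcome_prob_diff_left sum_subtractf sum_distrib_left right_diff_distrib)
  also have "(\<Sum>j\<in>UNIV. \<Sum>k\<in>UNIV. outcome_prob (H k) (B j k))
      = - (\<Sum>k\<in>UNIV. \<Sum>j\<in>UNIV. outcome_prob (H k) (B k j))"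
    by (subst sum.swap) (simp add: B_def outcome_prob_diff sum_negf[symmetric])
  also have "(\<Sum>j\<in>UNIV. \<Sum>k\<in>UNIV. outcome_prob (H j) (B j k)) = (\<Sum>j\<in>UNIV. outcome_prob (H j) (v $ j))"
    by (simp only: outcome_prob_sum[symmetric] sumB)
  finally show ?thesis by (simp add: pvm_differential_force H_def)
qed

text \<open>Composing two-level rotations avoids the exponential of the skew-Hermitian generator.\<close>

lemma rotation_product_curve:
  fixes b :: "'d \<Rightarrow> complex^'d"
  assumes b: "orthonormal_basis b" and "finite S" "S \<subseteq> {(j, k). j \<noteq> k}"
  shows "\<exists>B. (\<forall>t. orthonormal_basis (B t)) \<and> B 0 = b \<and>
    (\<forall>i. ((\<lambda>t. B t i) has_vector_derivative (\<Sum>(j, k)\<in>S.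
       if i = j then y j k *s b k else if i = k then - (cnj (y j k) *s b j) else 0)) (at (0::real)))"
  using assms(2,3)
proof (induction S)
  case empty
  show ?case using b by (intro exI[of _ "\<lambda>_. b"]) auto
next
  case (insert p S)
  obtain j k where p: "p = (j, k)" by (cases p)
  have jk: "j \<noteq> k" using insert.prems p by auto
  let ?v = "\<lambda>S i. \<Sum>(j, k)\<in>S. if i = j then y j k *s b k else if i = k then - (cnj (y j k) *s b j) else 0"
  obtain B where B: "\<And>t. orthonormal_basis (B t)" "B 0 = b"
      "\<And>i. ((\<lambda>t. B t i) has_vector_derivative ?v S i) (at 0)"
    using insert.IH insert.prems by blast
  \<comment> \<open>The modulus serves as angular speed and the argument as phase. At t = 0 the new
    rotation is the identity, so it keeps the velocities found so far and adds its own.\<close>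
  define c where "c = cmod (y j k)"
  define \<phi> where "\<phi> = Arg (y j k)"
  have y: "y j k = of_real c * cis \<phi>"
    unfolding c_def \<phi>_def using rcis_cmod_Arg[of "y j k"] by (simp only: rcis_def)
  have "((\<lambda>t. two_level_rotation (B t) j k \<phi> (c * t) i) has_vector_derivative ?v (insert p S) i) (at 0)" for i
  proof -
    have "c *\<^sub>R (cis \<phi> *s b k) = y j k *s b k" "c *\<^sub>R (cis (- \<phi>) *s b j) = cnj (y j k) *s b j"
      by (simp_all add: y vec_eq_iff scaleR_conv_of_real[where 'a=complex] cis_cnj mult.assoc)
    thus ?thesis
      using has_vector_derivative_rotation[where \<phi> = \<phi> and c = c and i = i and B = B
            and B' = "?v S", OF jk B(3)] B(2) jk insert.hyps p
      by (auto simp: algebra_simps split: if_splits)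
  qed
  moreover have "orthonormal_basis (two_level_rotation (B t) j k \<phi> (c * t))" for t
    by (rule two_level_rotation_orthonormal[OF B(1) jk])
  moreover have "two_level_rotation (B 0) j k \<phi> (c * 0) = b"
    by (simp add: B(2) two_level_rotation_0[OF jk])
  ultimately show ?case
    by (intro exI[of _ "\<lambda>t. two_level_rotation (B t) j k \<phi> (c * t)"]) blast
qed

text \<open>Each pair of indices is rotated twice, as (j, k) and as (k, j), and by skewness both
  contribute equally; hence the coefficients z / 2.\<close>

lemma skew_curve:
  fixes b :: "'d \<Rightarrow> complex^'d"
  assumes b: "orthonormal_basis b" and z: "\<And>j k. cnj (z j k) = - z k j" "\<And>j. z j j = 0"
  obtains B where "\<And>t. orthonormal_basis (B t)" "B 0 = b"
    "\<And>i. ((\<lambda>t. B t i) has_vector_derivative (\<Sum>k\<in>UNIV. z i k *s b k)) (at (0::real))"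
proof -
  let ?S = "{(j, k). j \<noteq> k} :: ('d \<times> 'd) set"
  let ?E = "\<lambda>i j k. if i = j then (z j k / 2) *s b k else if i = k then - (cnj (z j k / 2) *s b j) else 0"
  from rotation_product_curve[OF b finite order_refl, of "\<lambda>j k. z j k / 2"]
  obtain B where B: "\<forall>t. orthonormal_basis (B t)" "B 0 = b"
    "\<forall>i. ((\<lambda>t. B t i) has_vector_derivative (\<Sum>(j, k)\<in>?S. ?E i j k)) (at (0::real))"
    by (elim exE conjE) (rule that; assumption)
  have "(\<Sum>(j, k)\<in>?S. ?E i j k) = (\<Sum>k\<in>UNIV. z i k *s b k)" for i
  proof -
    have "(\<Sum>(j, k)\<in>?S. ?E i j k)
        = (\<Sum>(j, k)\<in>UNIV. (if i = j then (z j k / 2) *s b k else 0) + (if i = k then (z k j / 2) *s b j else 0))"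
      by (rule sum.mono_neutral_cong_left) (auto simp: z vec_eq_iff split: if_splits)
    also have "\<dots> = (\<Sum>j\<in>UNIV. \<Sum>k\<in>UNIV.
        (if i = j then (z j k / 2) *s b k else 0) + (if i = k then (z k j / 2) *s b j else 0))"
      by (subst sum.cartesian_product) simp
    also have "\<dots> = (\<Sum>k\<in>UNIV. (z i k / 2) *s b k) + (\<Sum>j\<in>UNIV. (z i j / 2) *s b j)"
    proof -
      have "(\<Sum>j\<in>UNIV. \<Sum>k\<in>UNIV. if i = j then (z j k / 2) *s b k else 0) = (\<Sum>k\<in>UNIV. (z i k / 2) *s b k)"
        by (subst sum.swap) simp
      thus ?thesis by (simp add: sum.distrib)
    qed
    also have "\<dots> = (\<Sum>k\<in>UNIV. z i k *s b k)"
      by (simp add: vec_eq_iff flip: sum.distrib distrib_right)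
    finally show ?thesis .
  qed
  with B show ?thesis by (intro that[of B]) simp_all
qed

lemma ket_bra2_sum_left: "ket_bra2 (\<Sum>k\<in>S. f k) w = (\<Sum>k\<in>S. ket_bra2 (f k) w)"
  by (simp add: ket_bra2_def vec_eq_iff sum_distrib_right)

lemma ket_bra2_sum_right: "ket_bra2 w (\<Sum>k\<in>S. f k) = (\<Sum>k\<in>S. ket_bra2 w (f k))"
  by (simp add: ket_bra2_def vec_eq_iff sum_distrib_left)

text \<open>The generator has the entries <b_k| (F_i - F_k) b_i> / 2 with F the forces. It is skew
  because F_i - F_k is Hermitian and changes sign when i and k are exchanged.\<close>

lemma gradient_tangent:
  fixes P :: "complex^'d^'d^'d"
  assumes P: "P \<in> rank_one_pvms" and herm: "hermitian \<rho>" "hermitian \<sigma>"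
  shows "pvm_gradient \<alpha> \<rho> \<sigma> P \<in> tangent_space rank_one_pvms P"
proof -
  obtain b where b: "orthonormal_basis b" "P = pvm_of_basis b"
    using P by (auto simp: rank_one_pvms_def)
  define D where "D i k = pvm_force \<alpha> \<rho> \<sigma> P i - pvm_force \<alpha> \<rho> \<sigma> P k" for i k
  have D: "hermitian (D i k)" for i k
    unfolding D_def by (intro hermitian_diff hermitian_force herm)
  have neg: "D i k *v w = - (D k i *v w)" for i k w
    by (simp add: D_def matrix_vector_mult_diff_rdistrib)
  define z where "z i k = cinner (b k) (D i k *v b i) / 2" for i k
  have cz: "cnj (z i k) = cinner (b i) (D i k *v b k) / 2" for i k
    by (simp add: z_def hermitian_cinner[OF D])
  have "cnj (z i k) = - z k i" for i k
    unfolding cz by (subst neg) (simp add: z_def cinner_def sum_negf)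
  moreover have "z i i = 0" for i by (simp add: z_def D_def)
  ultimately obtain B where B: "\<And>t. orthonormal_basis (B t)" "B 0 = b"
    "\<And>i. ((\<lambda>t. B t i) has_vector_derivative (\<Sum>k\<in>UNIV. z i k *s b k)) (at (0::real))"
    using skew_curve[OF b(1)] by blast
  have eq: "(\<chi> i. ket_bra2 (b i) (\<Sum>k\<in>UNIV. z i k *s b k) + ket_bra2 (\<Sum>k\<in>UNIV. z i k *s b k) (b i))
      = pvm_gradient \<alpha> \<rho> \<sigma> P"
  proof -
    have "ket_bra2 (b i) (z i k *s b k) = (1 / 2) *\<^sub>R (P $ i ** D i k ** P $ k)"
      "ket_bra2 (z i k *s b k) (b i) = (1 / 2) *\<^sub>R (P $ k ** D i k ** P $ i)" for i k
      unfolding b(2) pvm_of_basis_nth ket_bra_mult_mult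
      by (simp_all add: ket_bra2_def vec_eq_iff cz) (simp_all add: z_def scaleR_conv_of_real[where 'a=complex])
    thus ?thesis
      by (simp add: pvm_gradient_def D_def[symmetric] ket_bra2_sum_left ket_bra2_sum_right vec_eq_iff
          sum.distrib scaleR_sum_right scaleR_add_right)
  qed
  have "((\<lambda>t. pvm_of_basis (B t)) has_vector_derivative pvm_gradient \<alpha> \<rho> \<sigma> P) (at 0)"
    using has_vector_derivative_pvm_of_basis[where B = B, OF B(3)] eq B(2) by simp
  hence "curve_in rank_one_pvms P (pvm_gradient \<alpha> \<rho> \<sigma> P) (\<lambda>t. pvm_of_basis (B t))"
    unfolding curve_in_def using B(1,2) b(2) by (auto simp: rank_one_pvms_def)
  thus ?thesis by (auto simp: tangent_space_def)
qed

lemma divergence_derivative_along: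
  assumes P: "P \<in> rank_one_pvms" and pd: "pos_def \<rho>" "pos_def \<sigma>" "trace \<rho> = 1"
    and v: "v \<in> tangent_space rank_one_pvms P"
  shows "has_derivative_along rank_one_pvms (pvm_divergence \<alpha> \<rho> \<sigma>) P v (pvm_gradient \<alpha> \<rho> \<sigma> P \<bullet> v)"
  unfolding has_derivative_along_def
proof (intro allI impI)
  fix \<gamma> assume "curve_in rank_one_pvms P v \<gamma>"
  hence \<gamma>: "\<And>t. \<gamma> t \<in> rank_one_pvms" "\<gamma> 0 = P" "(\<gamma> has_vector_derivative v) (at 0)"
    by (auto simp: curve_in_def)
  show "((\<lambda>t. pvm_divergence \<alpha> \<rho> \<sigma> (\<gamma> t)) has_vector_derivative (pvm_gradient \<alpha> \<rho> \<sigma> P \<bullet> v)) (at 0)"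
    using has_real_derivative_pvm_divergence[OF \<gamma>(3,1) pd, of \<alpha>] gradient_inner[OF P _ _ v, of \<rho> \<sigma> \<alpha>]
      pd \<gamma>(2) unfolding has_real_derivative_iff_has_vector_derivative by (simp add: pos_def_def)
qed

lemma has_derivative_along_unique:
  assumes "has_derivative_along M F x v D" "has_derivative_along M F x v D'" "v \<in> tangent_space M x"
  shows "D = D'"
  using assms vector_derivative_unique_at unfolding has_derivative_along_def tangent_space_def by blast

lemma riemannian_gradient_eq:
  assumes g: "g \<in> tangent_space M x"
    and d: "\<And>v. v \<in> tangent_space M x \<Longrightarrow> has_derivative_along M f x v (g \<bullet> v)"
  shows "riemannian_gradient M f x = g"
  unfolding riemannian_gradient_def
proof (rule the_equality)
  fix h assume h: "h \<in> tangent_space M x \<and> (\<forall>v\<in>tangent_space M x. has_derivative_along M f x v (h \<bullet> v))"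
  have "h \<bullet> v = g \<bullet> v" if "v \<in> tangent_space M x" for v
    using has_derivative_along_unique[OF _ d[OF that] that] h that by blast
  \<comment> \<open>Testing with \<open>g\<close> and with \<open>h\<close>, which are both tangent,
    avoids showing that the tangent vectors form a subspace.\<close>
  hence "(h - g) \<bullet> (h - g) = 0"
    using g h by (simp add: inner_diff_right inner_diff_left)
  thus "h = g" by simp
qed (use g d in auto)

lemma pvm_riemannian_gradient:
  assumes P: "P \<in> rank_one_pvms" and pd: "pos_def \<rho>" "pos_def \<sigma>" "trace \<rho> = 1"
  shows "riemannian_gradient rank_one_pvms (pvm_divergence \<alpha> \<rho> \<sigma>) P = pvm_gradient \<alpha> \<rho> \<sigma> P"
  using pd by (intro riemannian_gradient_eq gradient_tangent divergence_derivative_along P)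
    (auto simp: pos_def_def)

section \<open>Differentiability of the gradient in the ambient space\<close>

lemma differentiable_bilinear:
  assumes "bounded_bilinear pr" "f differentiable (at x)" "g differentiable (at x)"
  shows "(\<lambda>x. pr (f x) (g x)) differentiable (at x)"
  using assms bounded_bilinear.FDERIV unfolding differentiable_def by blast

lemma differentiable_real_chain:
  fixes f :: "'a::real_normed_vector \<Rightarrow> real"
  assumes "(g has_real_derivative D) (at (f x))" "f differentiable (at x)"
  shows "(\<lambda>x. g (f x)) differentiable (at x)"
  using assms DERIV_compose_FDERIV unfolding differentiable_def by blast

lemma differentiable_vecI:
  fixes f :: "'a::real_normed_vector \<Rightarrow> 'b::euclidean_space^'n"
  assumes "\<And>i. (\<lambda>x. f x $ i) differentiable (at x)"
  shows "f differentiable (at x)"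
proof -
  have "linear (axis i :: 'b \<Rightarrow> 'b^'n)" for i
    by (rule linearI) (simp_all add: axis_def vec_eq_iff)
  hence "(\<lambda>x. axis i (f x $ i) :: 'b^'n) differentiable (at x)" for i
    using assms[of i] bounded_linear.has_derivative[of "axis i"]
    unfolding differentiable_def linear_conv_bounded_linear by blast
  hence "(\<lambda>x. \<Sum>i\<in>UNIV. axis i (f x $ i)) differentiable (at x)"
    by (intro differentiable_sum) auto
  moreover have "(\<lambda>x. \<Sum>i\<in>UNIV. axis i (f x $ i)) = f"
    by (simp add: fun_eq_iff vec_eq_iff axis_def)
  ultimately show ?thesis by simp
qed

lemma differentiable_outcome_prob: "(\<lambda>P. outcome_prob A (P $ j)) differentiable (at P)"
  using bounded_linear.has_derivative[OF bounded_linear_outcome_prob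
      bounded_linear.has_derivative[OF bounded_linear_vec_nth has_derivative_ident]]
  unfolding differentiable_def by blast

text \<open>The formula for \<open>pvm_gradient\<close> is defined on all tuples of matrices, and at
  a PVM every probability is positive. An ordinary derivative therefore exists, and it supplies one
  value for all curves with the same velocity, as the Hessian requires.\<close>

lemma gradient_differentiable:
  fixes P :: "complex^'d^'d^'d"
  assumes P: "P \<in> rank_one_pvms" and pd: "pos_def \<rho>" "pos_def \<sigma>" "trace \<rho> = 1"
  shows "pvm_gradient \<alpha> \<rho> \<sigma> differentiable (at P)"
proof -
  let ?x = "\<lambda>j P :: complex^'d^'d^'d. outcome_prob \<rho> (P $ j) / outcome_prob \<sigma> (P $ j)"
  have pos: "0 < outcome_prob \<rho> (P $ j)" "0 < outcome_prob \<sigma> (P $ j)" for j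
    using rank_one_outcome_pos[OF P] pd by auto
  hence xpos: "0 < ?x j P" for j by simp
  have x: "?x j differentiable (at P)" for j
    using pos(2)[of j] by (intro differentiable_divide differentiable_outcome_prob) simp
  have sl: "(\<lambda>P. div_slope \<alpha> (?x j P)) differentiable (at P)" for j
    by (rule differentiable_real_chain[OF has_real_derivative_div_slope[OF xpos] x])
  have pw: "(\<lambda>P. ?x j P powr \<alpha>) differentiable (at P)" for j
    by (rule differentiable_real_chain[where g = "\<lambda>y. y powr \<alpha>", OF has_real_derivative_powr[OF xpos] x])
  have tot: "pvm_total \<alpha> \<rho> \<sigma> differentiable (at P)"
    unfolding pvm_total_def[abs_def] div_term_def
    by (intro differentiable_sum differentiable_diff differentiable_mult differentiable_outcome_prob sl pw ballI finite)
  have lift: "(\<lambda>P. div_lift' \<alpha> (pvm_total \<alpha> \<rho> \<sigma> P)) differentiable (at P)"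
  proof (cases "\<alpha> = 1")
    case False
    have "pvm_total \<alpha> \<rho> \<sigma> P \<noteq> 0"
      using rank_one_total_pos[OF P pd False] by auto
    thus ?thesis
      using False tot unfolding div_lift'_def
      by (auto intro!: differentiable_divide differentiable_mult)
  qed (simp add: div_lift'_def)
  have force: "(\<lambda>P. pvm_force \<alpha> \<rho> \<sigma> P j) differentiable (at P)" for j
    unfolding pvm_force_def
    by (intro differentiable_bilinear[OF bounded_bilinear_scaleR] differentiable_diff lift sl pw differentiable_const)
  have nth: "(\<lambda>P. P $ j) differentiable (at P)" for j
    by (rule bounded_linear_imp_differentiable[OF bounded_linear_vec_nth])
  show ?thesis
  proof (rule differentiable_vecI)
    fix j
    show "(\<lambda>P. pvm_gradient \<alpha> \<rho> \<sigma> P $ j) differentiable (at P)"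
      unfolding pvm_gradient_def vec_lambda_beta
      by (intro differentiable_bilinear[OF bounded_bilinear_scaleR] differentiable_const differentiable_sum
          differentiable_add differentiable_bilinear[OF bounded_bilinear_matrix_mult] differentiable_diff
          force nth ballI finite)
  qed
qed

lemma has_vector_derivative_compose_differential:
  assumes "(G has_derivative G') (at (\<gamma> x))" "(\<gamma> has_vector_derivative v) (at x)"
  shows "((\<lambda>t. G (\<gamma> t)) has_vector_derivative G' v) (at x)"
proof -
  have "linear G'" using assms(1) by (rule has_derivative_linear)
  thus ?thesis
    using has_derivative_compose[OF assms(2)[unfolded has_vector_derivative_def] assms(1)]
    unfolding has_vector_derivative_def by (simp add: linear_cmul)
qed

text \<open>Tangent vectors are defined by curves based at parameter 0; re-centring makes the
  velocity at any time tangent.\<close>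

lemma curve_shift:
  assumes "\<And>t. \<gamma> t \<in> M" "(\<gamma> has_vector_derivative v) (at x)"
  shows "curve_in M (\<gamma> x) v (\<lambda>t. \<gamma> (x + t))"
proof -
  have "((\<lambda>t. x + t) has_derivative (\<lambda>t. t)) (at 0)"
    by (auto intro!: derivative_eq_intros)
  from has_derivative_compose[OF this, of \<gamma> "\<lambda>h. h *\<^sub>R v"] assms
  show ?thesis by (simp add: curve_in_def has_vector_derivative_def)
qed

text \<open>Differentiating the inner product of gradient and velocity along a curve gives the
  Hessian plus the gradient paired with the acceleration. At a critical point the latter is 0, so
  the Hessian in the two-level direction is the second derivative of the divergence, which is
  positive.\<close>

lemma second_order_optimal:
  fixes \<rho> \<sigma> :: "complex^'d^'d"
  assumes \<rho>: "faithful_density_operator \<rho>" and \<sigma>: "faithful_density_operator \<sigma>" and \<alpha>: "\<alpha> > 0"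
    and b: "orthonormal_basis b"
    and stat: "second_order_stationary_on rank_one_pvms (pvm_divergence \<alpha> \<rho> \<sigma>) (pvm_of_basis b)"
  shows "globally_optimal \<alpha> \<rho> \<sigma> (pvm_of_basis b)"
proof (rule ccontr)
  let ?M = "rank_one_pvms :: (complex^'d^'d^'d) set"
  let ?f = "pvm_divergence \<alpha> \<rho> \<sigma>" and ?G = "pvm_gradient \<alpha> \<rho> \<sigma>" and ?P = "pvm_of_basis b"
  assume no: "\<not> globally_optimal \<alpha> \<rho> \<sigma> ?P"
  note f = faithful_simps[OF \<rho>] faithful_simps(1)[OF \<sigma>]
  have herm: "hermitian \<rho>" "hermitian \<sigma>" using f by (auto simp: pos_def_def)
  have P: "?P \<in> ?M" using b by (auto simp: rank_one_pvms_def)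
  have crit: "critical_on ?M ?f ?P"
    and hess: "\<And>v. v \<in> tangent_space ?M ?P \<Longrightarrow> riemannian_hessian ?M ?f ?P v v \<le> 0"
    using stat by (auto simp: second_order_stationary_on_def)
  note GT = gradient_tangent[OF P herm, of \<alpha>]
  \<comment> \<open>The gradient is itself tangent, so criticality tested on it says that its norm
    is 0.\<close>
  have "?G ?P \<bullet> ?G ?P = 0"
    using has_derivative_along_unique[OF divergence_derivative_along[OF P f(1,3,2) GT] _ GT] crit GT
    unfolding critical_on_def by blast
  hence G0: "?G ?P = 0" by simp
  obtain G' where G': "(?G has_derivative G') (at ?P)"
    using gradient_differentiable[OF P f(1,3,2)] unfolding differentiable_def by blast
  obtain j k \<phi> where jk: "j \<noteq> k" and pos: "has_pos_second_derivative_at_0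
      (\<lambda>\<theta>. ?f (pvm_of_basis (two_level_rotation b j k \<phi> \<theta>)))"
    using not_optimal_two_level[OF \<rho> \<sigma> \<alpha> b critical_rotation[OF \<rho> \<sigma> \<alpha> b _ crit] no]
    unfolding admits_two_level_increase_def by auto
  interpret two_level \<alpha> \<rho> \<sigma> b j k \<phi>
    using \<alpha> f b jk by unfold_locales
  let ?v = "curve' 0"
  have ct: "curve' t \<in> tangent_space ?M (curve t)" for t
    using curve_shift[OF curve_mem curve_derivative] unfolding tangent_space_def by blast
  have "has_derivative_along ?M (riemannian_gradient ?M ?f) ?P ?v (G' ?v)"
    unfolding has_derivative_along_def
  proof (intro allI impI)
    fix \<gamma> assume "curve_in ?M ?P ?v \<gamma>"
    hence \<gamma>: "\<And>t. \<gamma> t \<in> ?M" "\<gamma> 0 = ?P" "(\<gamma> has_vector_derivative ?v) (at 0)"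
      by (auto simp: curve_in_def)
    show "((\<lambda>t. riemannian_gradient ?M ?f (\<gamma> t)) has_vector_derivative G' ?v) (at 0)"
      unfolding pvm_riemannian_gradient[OF \<gamma>(1) f(1,3,2)]
      by (rule has_vector_derivative_compose_differential[OF _ \<gamma>(3)]) (simp add: \<gamma>(2) G')
  qed
  hence "(THE D. has_derivative_along ?M (riemannian_gradient ?M ?f) ?P ?v D) = G' ?v"
    using has_derivative_along_unique ct[of 0] unfolding curve_0 by (intro the_equality) blast+
  hence le: "G' ?v \<bullet> ?v \<le> 0"
    using hess[of ?v] ct[of 0] by (simp add: riemannian_hessian_def curve_0)
  have rate: "rate t = ?G (curve t) \<bullet> curve' t" for t
  proof -
    have "((\<lambda>s. ?f (curve s)) has_real_derivative pvm_differential \<alpha> \<rho> \<sigma> (curve t) (curve' t)) (at t)"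
      by (rule has_real_derivative_pvm_divergence[OF curve_derivative curve_mem f(1,3,2)])
    from DERIV_unique[OF divergence_derivative this] show ?thesis
      by (simp add: gradient_inner[OF curve_mem herm ct])
  qed
  obtain w where w: "(curve' has_vector_derivative w) (at 0)"
    using curve'_differentiable by blast
  have "((\<lambda>t. ?G (curve t)) has_vector_derivative G' ?v) (at 0)"
    by (rule has_vector_derivative_compose_differential[OF _ curve_derivative]) (simp add: curve_0 G')
  from bounded_bilinear.has_vector_derivative[OF bounded_bilinear_inner this w]
  have "((\<lambda>t. ?G (curve t) \<bullet> curve' t) has_vector_derivative G' ?v \<bullet> ?v) (at 0)"
    by (simp add: curve_0 G0)
  hence r': "(rate has_real_derivative G' ?v \<bullet> ?v) (at 0)"
    unfolding has_real_derivative_iff_has_vector_derivative rate[abs_def] by (simp add: rate)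
  obtain g' D where g': "\<forall>\<^sub>F \<theta> in nhds 0. ((\<lambda>\<theta>. ?f (curve \<theta>)) has_real_derivative g' \<theta>) (at \<theta>)"
    and D: "(g' has_real_derivative D) (at 0)" "0 < D"
    using pos unfolding has_pos_second_derivative_at_0_def curve_def by blast
  \<comment> \<open>The first derivative in \<open>has_pos_second_derivative_at_0\<close> is
    existentially quantified; uniqueness identifies it with \<open>rate\<close> near 0.\<close>
  have "\<forall>\<^sub>F \<theta> in nhds 0. g' \<theta> = rate \<theta>"
    using g' by eventually_elim (rule DERIV_unique[OF _ divergence_derivative])
  hence "(g' has_real_derivative G' ?v \<bullet> ?v) (at 0)"
    using r' DERIV_cong_ev[OF refl _ refl, of g' rate] by blast
  hence "D = G' ?v \<bullet> ?v" using D(1) DERIV_unique by blast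
  thus False using D(2) le by simp
qed

theorem theorem6p1:
  fixes \<rho> \<sigma> :: "complex^'d^'d" and \<alpha> :: real
  assumes "faithful_density_operator \<rho>" and "faithful_density_operator \<sigma>" and "\<alpha> > 0"
  shows "(\<forall>P\<in>rank_one_pvms.
            local_maximum_on rank_one_pvms (pvm_divergence \<alpha> \<rho> \<sigma>) P \<longrightarrow>
            globally_optimal \<alpha> \<rho> \<sigma> P) \<and>
         (\<forall>P\<in>rank_one_pvms.
            second_order_stationary_on rank_one_pvms (pvm_divergence \<alpha> \<rho> \<sigma>) P \<longrightarrow>
            globally_optimal \<alpha> \<rho> \<sigma> P) \<and>
         (\<forall>b. orthonormal_basis b \<longrightarrow>
            critical_on rank_one_pvms (pvm_divergence \<alpha> \<rho> \<sigma>) (pvm_of_basis b) \<longrightarrow>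
            \<not> globally_optimal \<alpha> \<rho> \<sigma> (pvm_of_basis b) \<longrightarrow>
            admits_two_level_increase \<alpha> \<rho> \<sigma> b)"
proof (intro conjI ballI allI impI)
  fix P :: "complex^'d^'d^'d" assume P: "P \<in> rank_one_pvms"
  then obtain b where b: "orthonormal_basis b" "P = pvm_of_basis b" by (auto simp: rank_one_pvms_def)
  show "globally_optimal \<alpha> \<rho> \<sigma> P"
    if "local_maximum_on rank_one_pvms (pvm_divergence \<alpha> \<rho> \<sigma>) P"
    using local_maximum_optimal[OF assms b(1)] that b(2) by simp
  show "globally_optimal \<alpha> \<rho> \<sigma> P"
    if "second_order_stationary_on rank_one_pvms (pvm_divergence \<alpha> \<rho> \<sigma>) P"
    using second_order_optimal[OF assms b(1)] that b(2) by simp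
next
  fix b :: "'d \<Rightarrow> complex^'d"
  assume b: "orthonormal_basis b"
    and crit: "critical_on rank_one_pvms (pvm_divergence \<alpha> \<rho> \<sigma>) (pvm_of_basis b)"
    and no: "\<not> globally_optimal \<alpha> \<rho> \<sigma> (pvm_of_basis b)"
  show "admits_two_level_increase \<alpha> \<rho> \<sigma> b"
    by (rule not_optimal_two_level[OF assms b critical_rotation[OF assms b _ crit] no])
qed

end
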